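(* Let $x=P(x)$ be a minPPS in simple normal form with least fixed point $q^*$ satisfying $0<q^*<1$, let $0\le\epsilon\le1$, and let $y$ satisfy $0\le y\le q^*$ and $\|q^*-y\|_\infty\le 2^{-14|P|-3}\epsilon$. Then every policy $\sigma$ with $P_\sigma(y)=P(y)$ satisfies $\|q^*-q^*_\sigma\|_\infty\le\epsilon$.
   Context: A minPPS is a system $x_i=P_i(x)$, $i=1,\dots,n$, each $P_i$ the minimum of finitely many probabilistic polynomials (polynomials with rational nonnegative coefficients summing to at most $1$). Simple normal form: each $P_i$ is (L) $a_{i,0}+\sum_ja_{i,j}x_j$ with $a_{i,j}\ge0$, $\sum_{j\ge0}a_{i,j}\le1$; (Q) $x_jx_k$; or (M) $\min\{x_j,x_k\}$. $|P|$ is the total bit length. $q^*$ is the least fixed point in $[0,1]^n$. A policy $\sigma$ selects, at each form-M equation $x_i=\min\{x_j,x_k\}$, one of $x_j,x_k$; $P_\sigma$ is the resulting PPS (other equations unchanged) and $q^*_\sigma$ its least fixed point. *)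

theory Defs
  imports "HOL-Analysis.Analysis" "HOL-Library.Log_Nat"
begin

text \<open>
  Systems in simple normal form. The equation of a variable is
  \<open>LForm c a\<close>: the affine form with constant \<open>c\<close> and coefficients \<open>a j\<close>;
  \<open>QForm j k\<close>: the product of the variables \<open>j\<close> and \<open>k\<close>;
  \<open>MForm j k\<close>: the minimum of the variables \<open>j\<close> and \<open>k\<close>.
  The finite type \<open>'n\<close> is the index set of the variables.
\<close>

datatype 'n eqn =
    LForm rat "'n \<Rightarrow> rat"
  | QForm 'n 'n
  | MForm 'n 'n

type_synonym 'n system = "'n \<Rightarrow> 'n eqn"

fun eqn_ok :: "'n::finite eqn \<Rightarrow> bool" where
  "eqn_ok (LForm c a) \<longleftrightarrow> 0 \<le> c \<and> (\<forall>j. 0 \<le> a j) \<and> c + (\<Sum>j\<in>UNIV. a j) \<le> 1"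
| "eqn_ok (QForm j k) \<longleftrightarrow> True"
| "eqn_ok (MForm j k) \<longleftrightarrow> True"

definition minPPS_SNF :: "'n::finite system \<Rightarrow> bool" where
  "minPPS_SNF P \<longleftrightarrow> (\<forall>i. eqn_ok (P i))"

fun eval_eqn :: "'n::finite eqn \<Rightarrow> real ^ 'n \<Rightarrow> real" where
  "eval_eqn (LForm c a) x = of_rat c + (\<Sum>j\<in>UNIV. of_rat (a j) * x $ j)"
| "eval_eqn (QForm j k) x = x $ j * x $ k"
| "eval_eqn (MForm j k) x = min (x $ j) (x $ k)"

definition eval_sys :: "'n::finite system \<Rightarrow> real ^ 'n \<Rightarrow> real ^ 'n" where
  "eval_sys P x = (\<chi> i. eval_eqn (P i) x)"

text \<open>The order on vectors is the componentwise one, so \<open>{0..1}\<close> is the unit cube.\<close>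

definition is_least_fixpoint :: "'n::finite system \<Rightarrow> real ^ 'n \<Rightarrow> bool" where
  "is_least_fixpoint P q \<longleftrightarrow>
     q \<in> {0..1} \<and> eval_sys P q = q \<and> (\<forall>z\<in>{0..1}. eval_sys P z = z \<longrightarrow> q \<le> z)"

definition least_fixpoint :: "'n::finite system \<Rightarrow> real ^ 'n" where
  "least_fixpoint P = (THE q. is_least_fixpoint P q)"

text \<open>
  A policy is only constrained at the equations of form M; its values at the other
  variables are ignored.
\<close>

definition is_policy :: "'n system \<Rightarrow> ('n \<Rightarrow> 'n) \<Rightarrow> bool" where
  "is_policy P \<sigma> \<longleftrightarrow> (\<forall>i j k. P i = MForm j k \<longrightarrow> \<sigma> i \<in> {j, k})"

definition apply_policy :: "'n system \<Rightarrow> ('n \<Rightarrow> 'n) \<Rightarrow> 'n system" where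
  "apply_policy P \<sigma> = (\<lambda>i. case P i of
      MForm j k \<Rightarrow> LForm 0 (\<lambda>v. if v = \<sigma> i then 1 else 0)
    | e \<Rightarrow> e)"

text \<open>
  Total bit length of a sparse encoding: rationals are written in lowest terms as
  numerator and denominator in binary, only the terms with nonzero coefficient are
  written, and each occurrence of a variable on a right-hand side is written in binary
  with as many bits as the number of variables has. Separators, the tags for the three
  forms, and the left-hand sides (which are given by the order of the equations)
  are not counted; an encoding that also spends bits on these only has a larger size.
\<close>

definition rat_bits :: "rat \<Rightarrow> nat" where
  "rat_bits r = (case quotient_of r of (p, q) \<Rightarrow> nat (bitlen p) + nat (bitlen q))"

definition var_bits :: "'n::finite itself \<Rightarrow> nat" where
  "var_bits _ = nat (bitlen (int CARD('n)))"

fun eqn_bits :: "'n::finite eqn \<Rightarrow> nat" where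
  "eqn_bits (LForm c a) =
     (if c = 0 then 0 else rat_bits c)
     + (\<Sum>j | a j \<noteq> 0. rat_bits (a j) + var_bits TYPE('n))"
| "eqn_bits (QForm j k) = 2 * var_bits TYPE('n)"
| "eqn_bits (MForm j k) = 2 * var_bits TYPE('n)"

definition sys_bits :: "'n::finite system \<Rightarrow> nat" where
  "sys_bits P = (\<Sum>i\<in>UNIV. eqn_bits (P i))"

lemma minPPS_SNF_apply_policy:
  assumes "minPPS_SNF P"
  shows "minPPS_SNF (apply_policy P \<sigma>)"
proof -
  have "eqn_ok (apply_policy P \<sigma> i)" for i
    using assms[unfolded minPPS_SNF_def, rule_format, of i]
    by (cases "P i") (auto simp: apply_policy_def)
  then show ?thesis by (simp add: minPPS_SNF_def)
qed

lemma eval_eqn_mono: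
  assumes "eqn_ok e" "0 \<le> x" "x \<le> z"
  shows "eval_eqn e x \<le> eval_eqn e z"
proof -
  have x: "0 \<le> x $ i" "x $ i \<le> z $ i" for i
    using assms(2,3) by (auto simp: less_eq_vec_def)
  show ?thesis
  proof (cases e)
    case (LForm c a)
    then show ?thesis using assms(1) x
      by (auto intro!: sum_mono mult_left_mono)
  next
    case (QForm j k)
    then show ?thesis using x by (auto intro!: mult_mono order_trans[OF x(1) x(2)])
  next
    case (MForm j k)
    then show ?thesis using x[of j] x[of k] by auto
  qed
qed

lemma eval_eqn_bounds:
  assumes "eqn_ok e"
  shows "0 \<le> eval_eqn e 0" "eval_eqn e 1 \<le> 1"
proof -
  show "0 \<le> eval_eqn e 0" using assms by (cases e) auto
  show "eval_eqn e 1 \<le> 1"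
  proof (cases e)
    case (LForm c a)
    then have "of_rat (c + (\<Sum>j\<in>UNIV. a j)) \<le> (1::real)" using assms by auto
    then show ?thesis using LForm by (simp add: of_rat_add of_rat_sum)
  qed auto
qed

lemma eval_sys_mono:
  assumes "minPPS_SNF P" "0 \<le> x" "x \<le> z"
  shows "eval_sys P x \<le> eval_sys P z"
proof -
  have "eval_eqn (P i) x \<le> eval_eqn (P i) z" for i
    using assms by (intro eval_eqn_mono) (auto simp: minPPS_SNF_def)
  then show ?thesis by (simp add: eval_sys_def less_eq_vec_def)
qed

text \<open>The least fixed point is well defined (Knaster--Tarski on the unit cube).\<close>

lemma least_fixpoint_exists:
  assumes P: "minPPS_SNF P"
  shows "\<exists>q. is_least_fixpoint P q"
proof -
  define A where "A = {x. x \<in> {0..1} \<and> eval_sys P x \<le> x}"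
  define q where "q = (\<chi> i. INF x\<in>A. x $ i)"
  have one: "1 \<in> A"
    using P by (auto simp: A_def minPPS_SNF_def eval_sys_def less_eq_vec_def
        intro: eval_eqn_bounds(2))
  have bdd: "bdd_below ((\<lambda>x. x $ i) ` A)" for i
    by (rule bdd_belowI[of _ 0]) (auto simp: A_def less_eq_vec_def)
  have lower: "q \<le> x" if "x \<in> A" for x
    using that bdd by (auto simp: q_def less_eq_vec_def intro!: cINF_lower)
  have greatest: "z \<le> q" if "\<And>x. x \<in> A \<Longrightarrow> z \<le> x" for z
    using that one by (auto simp: q_def less_eq_vec_def intro!: cINF_greatest)
  have q0: "0 \<le> q" by (rule greatest) (auto simp: A_def)
  have q1: "q \<le> 1" by (rule lower[OF one])
  have le: "eval_sys P q \<le> q"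
  proof (rule greatest)
    fix x assume x: "x \<in> A"
    have "eval_sys P q \<le> eval_sys P x" by (rule eval_sys_mono[OF P q0 lower[OF x]])
    also have "\<dots> \<le> x" using x by (simp add: A_def)
    finally show "eval_sys P q \<le> x" .
  qed
  have "0 \<le> eval_sys P 0"
    using P by (auto simp: minPPS_SNF_def eval_sys_def less_eq_vec_def
        intro: eval_eqn_bounds(1))
  also have "\<dots> \<le> eval_sys P q" by (rule eval_sys_mono[OF P order_refl q0])
  finally have nn: "0 \<le> eval_sys P q" .
  have "eval_sys P q \<in> A"
    using nn le q1 eval_sys_mono[OF P nn le] by (auto simp: A_def)
  then have "q \<le> eval_sys P q" by (rule lower)
  with le have "eval_sys P q = q" by simp
  moreover have "q \<le> z" if "z \<in> {0..1}" "eval_sys P z = z" for z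
    using that by (intro lower) (simp add: A_def)
  ultimately show ?thesis using q0 q1 by (auto simp: is_least_fixpoint_def)
qed

lemma is_least_fixpoint_unique:
  assumes "is_least_fixpoint P q" "is_least_fixpoint P r"
  shows "q = r"
  using assms unfolding is_least_fixpoint_def by (meson order_antisym)

lemma least_fixpoint_is_least:
  assumes "minPPS_SNF P"
  shows "is_least_fixpoint P (least_fixpoint P)"
  using least_fixpoint_exists[OF assms] is_least_fixpoint_unique
  unfolding least_fixpoint_def by (metis theI)

end

theory Submission imports Defs begin

text \<open>
  Let \<open>q\<close> be the least fixed point of \<open>P\<close>, \<open>u = 1 - q\<close>, \<open>s = |P|\<close>, and \<open>R = P\<^sub>\<sigma>\<close>. Since
  \<open>R(y) = P(y) \<le> q\<close>, the point \<open>q\<close> is nearly fixed by \<open>R\<close>: \<open>q \<le> R(q) \<le> q + \<delta>\<close> with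
  \<open>\<delta> = 2\<^bsup>-14s-3\<^esup>\<epsilon>\<close>. As \<open>R(1) \<le> 1\<close>, moving from \<open>q\<close> in the direction \<open>u\<close> costs nothing, and there is
  slack at product equations (at least \<open>u\<^sub>ju\<^sub>k\<close>) and at affine equations with coefficient sum below \<open>1\<close>.
  A potential \<open>\<eta> \<ge> 2\<^bsup>-s\<^esup>\<close> transports this slack backwards along dependencies, so that
  \<open>z = q + t(u - \<beta>\<eta>)\<close> satisfies \<open>R(z) \<le> z \<le> q + \<epsilon>\<close> for suitable \<open>t\<close> and \<open>\<beta>\<close>; hence the least fixed point of
  \<open>R\<close> lies between \<open>q\<close> and \<open>q + \<epsilon>\<close>. A variable from which no slack is reachable would lie in a closed
  affine block with coefficient sums \<open>1\<close>, where \<open>u\<close> would have to be of order \<open>\<delta>\<close>.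

  Both steps rest on \<open>u \<ge> 2\<^bsup>-4s\<^esup>\<close>. With \<open>B\<close> the Jacobian at \<open>1\<close> of the system of a policy that is greedy at \<open>q\<close>,
  \<open>Bu - u\<close> is quadratic in \<open>u\<close> and nonnegative on the variables reachable from a minimiser of \<open>u\<close>
  (unless a deficient equation is reachable, which is easy). This gives a bounded \<open>w \<ge> 0\<close> with \<open>w(B - I)\<close>
  integral and nonnegative. It is nonzero because \<open>q\<close> is the least fixed point, so \<open>w(B - I)u \<ge> min u\<close>
  while \<open>w(B - I)u\<close> is at most of order \<open>(min u)\<^sup>2\<close>.
\<close>

section \<open>Graph closure and determinants\<close>

lemma obtain_maximal_set:
  fixes F :: "'a::finite set set"
  assumes "T \<in> F"
  obtains S where "S \<in> F" "\<And>S'. S' \<in> F \<Longrightarrow> S \<subseteq> S' \<Longrightarrow> S' = S"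
  using finite_has_maximal[of F] assms by (metis empty_iff finite)

text \<open>Maximality replaces an induction that adds predecessors one at a time. As each vertex
  enters only once, \<open>\<Phi>\<close> may carry a bound whose exponent is a sum over the
  set.\<close>

lemma backward_closed_superset:
  fixes E :: "('a::finite \<times> 'a) set"
  assumes base: "\<Phi> T"
    and step: "\<And>S i j. \<lbrakk>T \<subseteq> S; \<Phi> S; i \<notin> S; j \<in> S; (i, j) \<in> E\<rbrakk> \<Longrightarrow> \<Phi> (insert i S)"
  obtains S where "T \<subseteq> S" "\<Phi> S" "\<And>i j. (i, j) \<in> E \<Longrightarrow> j \<in> S \<Longrightarrow> i \<in> S"
proof -
  let ?F = "{S. T \<subseteq> S \<and> \<Phi> S}"
  have "T \<in> ?F" using base by simp
  then obtain S where S: "S \<in> ?F" "\<And>S'. S' \<in> ?F \<Longrightarrow> S \<subseteq> S' \<Longrightarrow> S' = S"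
    by (rule obtain_maximal_set) (rule that)
  have "i \<in> S" if "(i, j) \<in> E" "j \<in> S" for i j
  proof (rule ccontr)
    assume i: "i \<notin> S"
    have "insert i S \<in> ?F" using step[OF _ _ i that(2,1)] S(1) by auto
    then show False using S(2)[of "insert i S"] i by auto
  qed
  with S(1) show thesis by (intro that[of S]) auto
qed

text \<open>In the Leibniz expansion, extending the sum from permutations to all functions adds only
  nonnegative terms, and the larger sum factors row by row.\<close>

lemma abs_det_le_prod_rows:
  fixes A :: "real^'n^'n"
  shows "\<bar>det A\<bar> \<le> (\<Prod>i\<in>UNIV. \<Sum>j\<in>UNIV. \<bar>A $ i $ j\<bar>)"
proof -
  have "\<bar>det A\<bar> \<le> (\<Sum>p | p permutes UNIV. \<bar>of_int (sign p) * (\<Prod>i\<in>UNIV. A $ i $ p i)\<bar>)"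
    unfolding det_def by (rule sum_abs)
  also have "\<dots> = (\<Sum>p | p permutes (UNIV::'n set). \<Prod>i\<in>UNIV. \<bar>A $ i $ p i\<bar>)"
    by (intro sum.cong) (auto simp: abs_mult abs_prod sign_def)
  also have "\<dots> \<le> (\<Sum>p\<in>Pi\<^sub>E UNIV (\<lambda>_. UNIV). \<Prod>i\<in>UNIV. \<bar>A $ i $ p i\<bar>)"
    by (intro sum_mono2) (auto intro!: prod_nonneg finite_PiE)
  also have "\<dots> = (\<Prod>i\<in>UNIV. \<Sum>j\<in>UNIV. \<bar>A $ i $ j\<bar>)"
    by (subst prod_sum_PiE) auto
  finally show ?thesis .
qed

lemma det_Ints:
  fixes A :: "real^'n^'n"
  assumes "\<And>i j. A $ i $ j \<in> \<int>"
  shows "det A \<in> \<int>"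
  unfolding det_def using assms
  by (intro Ints_sum Ints_mult Ints_prod) auto

section \<open>Left vectors of nonnegative matrices\<close>

text \<open>
  The vector \<open>x\<close> witnesses that the principal submatrix of \<open>B\<close> on \<open>T\<close> has spectral radius
  below \<open>1\<close>.
\<close>

definition subcritical :: "('n \<Rightarrow> 'n \<Rightarrow> real) \<Rightarrow> 'n set \<Rightarrow> ('n \<Rightarrow> real) \<Rightarrow> bool" where
  "subcritical B T x \<longleftrightarrow> (\<forall>j\<in>T. 0 < x j \<and> (\<Sum>i\<in>T. x i * B i j) < x j)"

text \<open>A minimum principle: at an index minimising \<open>w k / x k\<close>, a negative ratio
  would make the strict inequality for \<open>x\<close> contradict the one for
  \<open>w\<close>.\<close>

lemma subcritical_nonneg:
  fixes B :: "'n::finite \<Rightarrow> 'n \<Rightarrow> real"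
  assumes B: "\<And>i j. 0 \<le> B i j" and x: "subcritical B T x"
    and w: "\<And>j. j \<in> T \<Longrightarrow> (\<Sum>i\<in>T. w i * B i j) \<le> w j" and j: "j \<in> T"
  shows "0 \<le> w j"
proof -
  have "finite T" by simp
  let ?r = "\<lambda>k. w k / x k"
  obtain k where k: "k \<in> T" "\<And>i. i \<in> T \<Longrightarrow> ?r k \<le> ?r i"
    using ex_min_if_finite[of "?r ` T"] j \<open>finite T\<close> by (auto simp: not_less)
  have xk: "0 < x i" if "i \<in> T" for i using x that by (auto simp: subcritical_def)
  have "0 \<le> ?r k"
  proof (rule ccontr)
    assume neg: "\<not> 0 \<le> ?r k"
    have "w k = ?r k * x k" using xk[OF k(1)] by simp
    also have "\<dots> < ?r k * (\<Sum>i\<in>T. x i * B i k)"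
      using neg x k(1) by (intro mult_strict_left_mono_neg) (auto simp: subcritical_def)
    also have "\<dots> \<le> (\<Sum>i\<in>T. w i * B i k)"
      unfolding sum_distrib_left
    proof (rule sum_mono)
      fix i assume i: "i \<in> T"
      have "?r k * x i \<le> w i" using k(2)[OF i] xk[OF i] by (simp add: field_simps)
      then show "?r k * (x i * B i k) \<le> w i * B i k"
        using mult_right_mono[OF _ B, of "?r k * x i" "w i" i k] by (simp only: mult.assoc)
    qed
    also have "\<dots> \<le> w k" by (rule w[OF k(1)])
    finally show False by simp
  qed
  then have "0 \<le> ?r j" using k(2)[OF j] by simp
  then show ?thesis using xk[OF j] by (simp add: zero_le_divide_iff)
qed

text \<open>The vector \<open>u\<close> certifies spectral radius at least 1 on \<open>S\<close>, so
  a left vector with \<open>w B >= w\<close> is to be expected. Integrality is the point: a nonzero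
  entry of \<open>w B - w\<close> is at least 1, while Cramer's rule keeps \<open>w\<close>
  bounded.\<close>

lemma supercritical_left_vector:
  fixes B :: "'n::finite \<Rightarrow> 'n \<Rightarrow> real" and u :: "'n \<Rightarrow> real"
  assumes B: "\<And>i j. 0 \<le> B i j"
    and S: "S \<noteq> {}" and u: "\<And>i. i \<in> S \<Longrightarrow> 0 < u i"
    and super: "\<And>i. i \<in> S \<Longrightarrow> u i \<le> (\<Sum>j\<in>S. B i j * u j)"
    and D: "\<And>i. D i \<in> \<int>" "\<And>i. 1 \<le> D i" "\<And>i j. D i * B i j \<in> \<int>"
    and N: "\<And>i. D i * (1 + (\<Sum>j\<in>UNIV. B i j)) \<le> N i"
  obtains w v where "\<And>i. 0 \<le> w i" "0 < w v" "\<And>i. 0 < w i \<Longrightarrow> i \<in> S"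
    "\<And>i. w i \<le> (\<Prod>i\<in>UNIV. N i)"
    "\<And>j. w j \<le> (\<Sum>i\<in>UNIV. w i * B i j)"
    "\<And>j. (\<Sum>i\<in>UNIV. w i * B i j) - w j \<in> \<int>"
proof -
  let ?F = "{T. T \<subseteq> S \<and> (\<exists>x. subcritical B T x)}"
  have "{} \<in> ?F" by (simp add: subcritical_def)
  then obtain T where T: "T \<in> ?F" "\<And>T'. T' \<in> ?F \<Longrightarrow> T \<subseteq> T' \<Longrightarrow> T' = T"
    by (rule obtain_maximal_set) (rule that)
  then obtain x where x: "subcritical B T x" by auto
  \<comment> \<open>If \<open>T = S\<close>, then pairing \<open>x B\<close> with \<open>u\<close>
    gives less than the pairing of \<open>x\<close> with \<open>u\<close>, whereas pairing
    \<open>x\<close> with \<open>B u\<close> gives at least as much.\<close>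
  have "T \<noteq> S"
  proof
    assume TS: "T = S"
    have "(\<Sum>j\<in>S. (\<Sum>i\<in>S. x i * B i j) * u j) < (\<Sum>j\<in>S. x j * u j)"
      using x u S TS by (intro sum_strict_mono) (auto simp: subcritical_def)
    also have "\<dots> \<le> (\<Sum>i\<in>S. x i * (\<Sum>j\<in>S. B i j * u j))"
      using x super TS by (intro sum_mono mult_left_mono) (auto simp: subcritical_def less_imp_le)
    also have "\<dots> = (\<Sum>j\<in>S. (\<Sum>i\<in>S. x i * B i j) * u j)"
      unfolding sum_distrib_left sum_distrib_right mult.assoc by (rule sum.swap)
    finally show False by simp
  qed
  then obtain v where v: "v \<in> S" "v \<notin> T" using T(1) by auto
  txt \<open>
    By maximality of \<open>T\<close>, the solution of \<open>w\<^sub>v = 1\<close>, \<open>(w B)\<^sub>j = w\<^sub>j\<close> for \<open>j \<in> T\<close> that vanishes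
    elsewhere satisfies \<open>w B \<ge> w\<close>. Cramer's rule for the integer matrix \<open>K\<close> makes
    \<open>\<bar>det K\<bar> w\<close> integral and bounds it.
  \<close>
  define K :: "real^'n^'n"
    where "K = (\<chi> j i. D i * ((if i = j then 1 else 0) - (if j \<in> T then B i j else 0)))"
  have K_mult: "(K *v y) $ j = D j * y $ j - (if j \<in> T then \<Sum>i\<in>UNIV. D i * y $ i * B i j else 0)"
    for y j
  proof -
    have "(K *v y) $ j = (\<Sum>i\<in>UNIV. (if i = j then D i * y $ i else 0)
        - (if j \<in> T then D i * y $ i * B i j else 0))"
      unfolding matrix_vector_mult_def K_def by (auto intro!: sum.cong simp: algebra_simps)
    then show ?thesis by (simp add: sum_subtractf)
  qed
  have D0: "0 < D i" for i using D(2)[of i] by linarith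
  have sumT: "(\<Sum>i\<in>UNIV. f i) = (\<Sum>i\<in>A. f i)" if "\<And>i. i \<notin> A \<Longrightarrow> f i = 0" for A and f :: "'n \<Rightarrow> real"
    using that by (intro sum.mono_neutral_right) auto
  \<comment> \<open>A kernel vector vanishes off \<open>T\<close>. On \<open>T\<close>, the minimum
    principle applies both to \<open>D j * y $ j\<close> and to its negative.\<close>
  have "det K \<noteq> 0"
  proof -
    have "y = 0" if y: "K *v y = 0" for y
    proof -
      have out: "y $ j = 0" if "j \<notin> T" for j
        using K_mult[of y j] that y D0[of j] by simp
      have eq: "D j * y $ j = (\<Sum>i\<in>T. D i * y $ i * B i j)" if "j \<in> T" for j
        using K_mult[of y j] that y sumT[of T "\<lambda>i. D i * y $ i * B i j"] out by simp
      have "0 \<le> D j * y $ j" if "j \<in> T" for j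
        by (rule subcritical_nonneg[OF B x _ that, of "\<lambda>j. D j * y $ j"]) (simp add: eq)
      moreover have "0 \<le> - (D j * y $ j)" if "j \<in> T" for j
        by (rule subcritical_nonneg[OF B x _ that, of "\<lambda>j. - (D j * y $ j)"])
          (simp add: eq sum_negf)
      ultimately have "y $ j = 0" if "j \<in> T" for j
        using that D0[of j] by (metis antisym_conv mult_eq_0_iff neg_0_le_iff_le less_irrefl)
      with out show "y = 0" by (metis vec_eq_iff zero_index)
    qed
    then have "\<exists>A'. A' ** K = mat 1"
      by (simp add: matrix_left_invertible_ker)
    then show ?thesis using invertible_det_nz invertible_left_inverse by blast
  qed
  define y where "y = (\<chi> k. det (\<chi> i j. if j = k then axis v 1 $ i else K $ i $ j) / det K)"
  have Ky: "K *v y = axis v 1" using cramer[OF \<open>det K \<noteq> 0\<close>] y_def by blast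
  \<comment> \<open>Column \<open>i\<close> of \<open>K\<close> was scaled by \<open>D i\<close> for
    integrality; this undoes the scaling.\<close>
  define w0 where "w0 i = D i * y $ i" for i
  have out: "w0 j = (if j = v then 1 else 0)" if "j \<notin> T" for j
    using K_mult[of y j] that Ky by (simp add: w0_def axis_def)
  have sup: "w0 i \<noteq> 0 \<Longrightarrow> i \<in> insert v T" for i using out[of i] by (auto split: if_splits)
  have inT: "w0 j = (\<Sum>i\<in>UNIV. w0 i * B i j)" if "j \<in> T" for j
    using K_mult[of y j] that Ky v by (auto simp: w0_def axis_def split: if_splits)
  have sumvT: "(\<Sum>i\<in>UNIV. w0 i * B i j) = (\<Sum>i\<in>T. w0 i * B i j) + B v j" for j
  proof -
    have "(\<Sum>i\<in>UNIV. w0 i * B i j) = (\<Sum>i\<in>insert v T. w0 i * B i j)"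
      using sup by (intro sumT) (metis mult_eq_0_iff)
    then show ?thesis using v out[of v] by simp
  qed
  have w0T: "0 \<le> w0 j" if "j \<in> T" for j
    by (rule subcritical_nonneg[OF B x _ that]) (simp add: inT[unfolded sumvT] B)
  have w0: "0 \<le> w0 j" for j using w0T out by (cases "j \<in> T") auto
  \<comment> \<open>Otherwise there is room at \<open>v\<close>: adding a small multiple of
    \<open>x\<close> to \<open>w0\<close> makes the inequalities on \<open>T\<close> strict, so
    \<open>insert v T\<close> is subcritical, against maximality.\<close>
  have atv: "1 \<le> (\<Sum>i\<in>UNIV. w0 i * B i v)"
  proof (rule ccontr)
    assume less: "\<not> ?thesis"
    define g where "g = 1 - (\<Sum>i\<in>UNIV. w0 i * B i v)"
    define h where "h = (\<Sum>i\<in>T. x i * B i v)"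
    have h: "0 \<le> h" unfolding h_def using x B
      by (intro sum_nonneg mult_nonneg_nonneg) (auto simp: subcritical_def less_imp_le)
    define e where "e = g / (1 + h)"
    have e: "0 < e" "e * h < g"
      using h less by (auto simp: e_def g_def field_simps)
    let ?x = "\<lambda>i. if i = v then 1 else w0 i + e * x i"
    have fT: "finite T" by simp
    have sm: "(\<Sum>i\<in>insert v T. ?x i * B i j) = (\<Sum>i\<in>UNIV. w0 i * B i j) + e * (\<Sum>i\<in>T. x i * B i j)"
      for j
    proof -
      have "(\<Sum>i\<in>T. ?x i * B i j) = (\<Sum>i\<in>T. w0 i * B i j + e * (x i * B i j))"
        using v by (intro sum.cong) (auto simp: algebra_simps)
      then show ?thesis using v fT by (simp add: sumvT sum.distrib sum_distrib_left)
    qed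
    have "subcritical B (insert v T) ?x"
      unfolding subcritical_def
    proof
      fix j assume j: "j \<in> insert v T"
      show "0 < ?x j \<and> (\<Sum>i\<in>insert v T. ?x i * B i j) < ?x j"
      proof (cases "j = v")
        case True
        then show ?thesis unfolding sm using e(2) by (simp add: g_def h_def)
      next
        case False
        then have jT: "j \<in> T" using j by simp
        then have "0 < x j" "(\<Sum>i\<in>T. x i * B i j) < x j" using x by (auto simp: subcritical_def)
        then show ?thesis unfolding sm using False e(1) w0[of j] inT[OF jT]
          by (auto intro: add_nonneg_pos)
      qed
    qed
    then have "insert v T \<in> ?F" using T(1) v by auto
    then show False using T(2)[of "insert v T"] v by auto
  qed
  have ge: "w0 j \<le> (\<Sum>i\<in>UNIV. w0 i * B i j)" for j
  proof (cases "j \<in> T")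
    case True then show ?thesis using inT by simp
  next
    case False
    have "0 \<le> (\<Sum>i\<in>UNIV. w0 i * B i j)" by (intro sum_nonneg mult_nonneg_nonneg w0 B)
    then show ?thesis using False out[of j] atv by auto
  qed
  define a where "a = \<bar>det K\<bar>"
  have a: "0 < a" using \<open>det K \<noteq> 0\<close> by (simp add: a_def)
  define w where "w i = a * w0 i" for i
  define M where "M k = (\<chi> i j. if j = k then axis v 1 $ i else K $ i $ j)" for k
  have wM: "w k = D k * (sgn (det K) * det (M k))" for k
    using \<open>det K \<noteq> 0\<close> by (auto simp: w_def w0_def y_def M_def a_def sgn_real_def)
  have K_int: "K $ i $ j \<in> \<int>" for i j
    using D by (auto simp: K_def algebra_simps)
  have M_int: "det (M k) \<in> \<int>" for k
    by (rule det_Ints) (use K_int in \<open>auto simp: M_def axis_def\<close>)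
  have N0: "D i \<le> N i" for i
  proof -
    have "D i * 1 \<le> D i * (1 + (\<Sum>j\<in>UNIV. B i j))"
      using D0[of i] B by (intro mult_left_mono) (auto intro: sum_nonneg less_imp_le)
    with N[of i] show ?thesis by simp
  qed
  have w_le: "w k \<le> (\<Prod>i\<in>UNIV. N i)" for k
  proof -
    have "w k \<le> \<bar>w k\<bar>" by simp
    also have "\<dots> = D k * \<bar>det (M k)\<bar>"
      using D0[of k] \<open>det K \<noteq> 0\<close> by (simp add: wM abs_mult abs_sgn_eq)
    \<comment> \<open>Transposing gives a bound by columns: column \<open>i\<close> of
      \<open>K\<close> has absolute sum at most \<open>N i\<close>, and the replaced column has sum
      1, which leaves the factor \<open>N k\<close> to absorb \<open>D k\<close>.\<close>
    also have "\<bar>det (M k)\<bar> = \<bar>det (transpose (M k))\<bar>" by simp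
    also have "\<dots> \<le> (\<Prod>i\<in>UNIV. \<Sum>j\<in>UNIV. \<bar>transpose (M k) $ i $ j\<bar>)" by (rule abs_det_le_prod_rows)
    also have "\<dots> \<le> (\<Prod>i\<in>UNIV. if i = k then 1 else N i)"
    proof (intro prod_mono conjI)
      fix i
      show "(\<Sum>j\<in>UNIV. \<bar>transpose (M k) $ i $ j\<bar>) \<le> (if i = k then 1 else N i)"
      proof (cases "i = k")
        case True
        then have "(\<Sum>j\<in>UNIV. \<bar>transpose (M k) $ i $ j\<bar>) = (\<Sum>j\<in>UNIV. if j = v then 1 else 0)"
          by (intro sum.cong) (auto simp: M_def transpose_def axis_def)
        then show ?thesis using True by simp
      next
        case False
        then have "(\<Sum>j\<in>UNIV. \<bar>transpose (M k) $ i $ j\<bar>)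
            \<le> (\<Sum>j\<in>UNIV. (if j = i then D i else 0) + D i * B i j)"
          using D0[of i] B
          by (intro sum_mono) (auto simp: M_def transpose_def K_def abs_mult algebra_simps
              intro!: abs_leI mult_left_mono)
        also have "\<dots> = D i * (1 + (\<Sum>j\<in>UNIV. B i j))"
          by (simp add: sum.distrib sum_distrib_left algebra_simps)
        also have "\<dots> \<le> N i" by (rule N)
        finally show ?thesis using False by simp
      qed
    qed (auto intro: sum_nonneg)
    also have "\<dots> = (\<Prod>i\<in>UNIV - {k}. N i)"
      by (subst prod.remove[of _ k]) (auto intro!: prod.cong)
    finally have "w k \<le> D k * (\<Prod>i\<in>UNIV - {k}. N i)" using D0[of k] by simp
    also have "\<dots> \<le> N k * (\<Prod>i\<in>UNIV - {k}. N i)"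
      using N0 by (intro mult_right_mono prod_nonneg) (auto intro: order_trans[OF less_imp_le[OF D0]])
    also have "\<dots> = (\<Prod>i\<in>UNIV. N i)" by (subst (2) prod.remove[of _ k]) auto
    finally show ?thesis .
  qed
  have sumw: "(\<Sum>i\<in>UNIV. w i * B i j) = a * (\<Sum>i\<in>UNIV. w0 i * B i j)" for j
    by (simp add: w_def sum_distrib_left mult.assoc)
  have sg: "sgn (det K) \<in> \<int>" by (simp add: sgn_real_def)
  show thesis
  proof (rule that[of w v])
    show "0 \<le> w i" for i using a w0 by (simp add: w_def)
    show "0 < w v" using a out[OF v(2)] by (simp add: w_def)
    show "i \<in> S" if "0 < w i" for i
    proof -
      have "w0 i \<noteq> 0" using that by (auto simp: w_def)
      then show ?thesis using sup[of i] T(1) v by auto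
    qed
    show "w j \<le> (\<Sum>i\<in>UNIV. w i * B i j)" for j
      unfolding sumw using a ge by (simp add: w_def)
    show "(\<Sum>i\<in>UNIV. w i * B i j) - w j \<in> \<int>" for j
    proof -
      have "w i * B i j = sgn (det K) * det (M i) * (D i * B i j)" for i by (simp add: wM)
      moreover have "sgn (det K) * det (M i) * (D i * B i j) \<in> \<int>" for i
        by (intro Ints_mult sg M_int D(3))
      ultimately have "w i * B i j \<in> \<int>" for i by presburger
      moreover have "w j \<in> \<int>" unfolding wM using sg M_int D by simp
      ultimately show ?thesis by (intro Ints_diff Ints_sum) auto
    qed
  qed (rule w_le)
qed

section \<open>Systems with a fixed policy\<close>

text \<open>\<open>B\<close> is the Jacobian at the all-ones vector, \<open>b i\<close> a bit budget
  for equation \<open>i\<close>, and \<open>D i\<close> a common denominator of row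
  \<open>i\<close>. The factor 2 in \<open>B_ge\<close> lets potentials double along edges.
  \<open>no_trap\<close> is what remains of positivity and minimality of the fixed point: an affine
  block without constants or exits could be reset to 0.\<close>

locale quadratic_net =
  fixes Q :: "'n::finite set" and l r :: "'n \<Rightarrow> 'n" and B :: "'n \<Rightarrow> 'n \<Rightarrow> real"
    and c :: "'n \<Rightarrow> real" and b :: "'n \<Rightarrow> nat" and D :: "'n \<Rightarrow> real"
  assumes B_nonneg: "0 \<le> B i j"
    and B_Q: "i \<in> Q \<Longrightarrow> B i j = of_bool (j = l i) + of_bool (j = r i)"
    and c_nonneg: "i \<notin> Q \<Longrightarrow> 0 \<le> c i"
    and sum_le_1: "i \<notin> Q \<Longrightarrow> c i + (\<Sum>j\<in>UNIV. B i j) \<le> 1"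
    and b_pos: "1 \<le> b i"
    and B_ge: "B i j \<noteq> 0 \<Longrightarrow> 2 / 2 ^ b i \<le> B i j"
    and c_ge: "i \<notin> Q \<Longrightarrow> c i \<noteq> 0 \<Longrightarrow> 2 / 2 ^ b i \<le> c i"
    and deficit_ge: "i \<notin> Q \<Longrightarrow> c i + (\<Sum>j\<in>UNIV. B i j) \<noteq> 1
      \<Longrightarrow> 1 / 2 ^ b i \<le> 1 - c i - (\<Sum>j\<in>UNIV. B i j)"
    and D_int: "D i \<in> \<int>" and D_ge: "1 \<le> D i" and DB_int: "D i * B i j \<in> \<int>"
    and D_le: "D i * (1 + (\<Sum>j\<in>UNIV. B i j)) \<le> 2 ^ b i"
    and no_trap: "W \<noteq> {} \<Longrightarrow> W \<inter> Q = {} \<Longrightarrow>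
      \<exists>i\<in>W. c i \<noteq> 0 \<or> (\<exists>j. B i j \<noteq> 0 \<and> j \<notin> W)"
begin

definition ev :: "('n \<Rightarrow> real) \<Rightarrow> 'n \<Rightarrow> real" where
  "ev x i = (if i \<in> Q then x (l i) * x (r i) else c i + (\<Sum>j\<in>UNIV. B i j * x j))"

definition nbits :: nat where "nbits = (\<Sum>i\<in>UNIV. b i)"

definition deficient :: "'n set" where
  "deficient = {i. i \<notin> Q \<and> c i + (\<Sum>j\<in>UNIV. B i j) \<noteq> 1}"

lemma b_le_nbits: "b i \<le> nbits"
  unfolding nbits_def by (rule member_le_sum) auto

lemma card_le_nbits: "CARD('n) \<le> nbits"
  using sum_mono[of UNIV "\<lambda>_. 1" b] b_pos by (simp add: nbits_def)

lemma nbits_pos: "1 \<le> nbits"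
  using b_pos b_le_nbits order_trans by blast

lemma inverse_power_nbits_le: "1 / 2 ^ nbits \<le> 1 / (2::real) ^ b i"
  using b_le_nbits[of i] by (intro divide_left_mono power_increasing) auto

lemma B_le_sum: "0 \<le> f j \<Longrightarrow> (\<And>k. 0 \<le> f k) \<Longrightarrow> B i j * f j \<le> (\<Sum>k\<in>UNIV. B i k * f k)"
  by (rule member_le_sum) (auto simp: B_nonneg)

lemma sum_B_Q: "i \<in> Q \<Longrightarrow> (\<Sum>j\<in>UNIV. B i j * f j) = f (l i) + f (r i)"
  by (simp add: B_Q distrib_right sum.distrib of_bool_def if_distrib[of "\<lambda>x. x * _"] cong: if_cong)

section \<open>Potentials and bounds along paths\<close>

text \<open>Start with the indicator of \<open>T\<close> and add predecessors; a new vertex loses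
  the factor \<open>2 ^ b i\<close>, charged once, so the total loss is at most
  \<open>2 ^ nbits\<close>. Of the doubling off \<open>T\<close>, one half will maintain the
  potential and the other will pay for errors.\<close>

lemma potential:
  obtains S \<eta> where "T \<subseteq> S" "\<And>i. 0 \<le> \<eta> i" "\<And>i. \<eta> i \<le> 1" "\<And>i. i \<in> S \<Longrightarrow> 1 / 2 ^ nbits \<le> \<eta> i"
    "\<And>i. i \<in> S \<Longrightarrow> i \<notin> T \<Longrightarrow> 2 * \<eta> i \<le> (\<Sum>j\<in>UNIV. B i j * \<eta> j)"
    "\<And>i j. B i j \<noteq> 0 \<Longrightarrow> j \<in> S \<Longrightarrow> i \<in> S"
proof -
  define \<Phi> where "\<Phi> S \<longleftrightarrow> (\<exists>\<eta>. (\<forall>i. 0 \<le> \<eta> i \<and> \<eta> i \<le> 1 \<and> (i \<notin> S \<longrightarrow> \<eta> i = 0)) \<and>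
     (\<forall>i\<in>S. 1 / 2 ^ sum b (S - T) \<le> \<eta> i) \<and>
     (\<forall>i\<in>S - T. 2 * \<eta> i \<le> (\<Sum>j\<in>UNIV. B i j * \<eta> j)))" for S
  obtain S where S: "T \<subseteq> S" "\<Phi> S" "\<And>i j. (i, j) \<in> {(i, j). B i j \<noteq> 0} \<Longrightarrow> j \<in> S \<Longrightarrow> i \<in> S"
  proof (rule backward_closed_superset[of \<Phi> T "{(i, j). B i j \<noteq> 0}"])
    show "\<Phi> T" unfolding \<Phi>_def by (rule exI[of _ "\<lambda>i. if i \<in> T then 1 else 0"]) auto
  next
    fix S i j assume TS: "T \<subseteq> S" and "\<Phi> S" and i: "i \<notin> S" and j: "j \<in> S"
      and "(i, j) \<in> {(i, j). B i j \<noteq> 0}"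
    then have Bij: "B i j \<noteq> 0" by simp
    obtain \<eta> where "\<forall>i. 0 \<le> \<eta> i \<and> \<eta> i \<le> 1 \<and> (i \<notin> S \<longrightarrow> \<eta> i = 0)"
      "\<forall>i\<in>S. 1 / 2 ^ sum b (S - T) \<le> \<eta> i"
      "\<forall>i\<in>S - T. 2 * \<eta> i \<le> (\<Sum>j\<in>UNIV. B i j * \<eta> j)"
      using \<open>\<Phi> S\<close> unfolding \<Phi>_def by auto
    then have \<eta>: "\<And>i. 0 \<le> \<eta> i" "\<And>i. \<eta> i \<le> 1" "\<And>i. i \<notin> S \<Longrightarrow> \<eta> i = 0"
      "\<And>i. i \<in> S \<Longrightarrow> 1 / 2 ^ sum b (S - T) \<le> \<eta> i"
      "\<And>i. i \<in> S \<Longrightarrow> i \<notin> T \<Longrightarrow> 2 * \<eta> i \<le> (\<Sum>j\<in>UNIV. B i j * \<eta> j)"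
      by blast+
    let ?\<eta> = "\<eta>(i := \<eta> j / 2 ^ b i)"
    have "i \<noteq> j" "i \<notin> T" "finite S" using i j TS by auto
    then have sm: "sum b (insert i S - T) = b i + sum b (S - T)"
      using i by (simp add: insert_Diff_if)
    have le: "\<eta> k \<le> ?\<eta> k" for k using \<eta>(1)[of j] \<eta>(3)[OF i] by simp
    have nn: "0 \<le> ?\<eta> k" for k using \<eta>(1) le order_trans by blast
    have quot: "x / 2 ^ n \<le> x" if "0 \<le> x" for x :: real and n
      using that divide_left_mono[of 1 "2 ^ n" x] by simp
    show "\<Phi> (insert i S)" unfolding \<Phi>_def
    proof (intro exI[of _ ?\<eta>] conjI allI ballI impI)
      fix k
      show "0 \<le> ?\<eta> k" by (rule nn)
      show "?\<eta> k \<le> 1"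
        using \<eta>(2)[of k] order_trans[OF quot[OF \<eta>(1)[of j], of "b i"] \<eta>(2)[of j]]
        by (cases "k = i") simp_all
      show "?\<eta> k = 0" if "k \<notin> insert i S" using that \<eta>(3) by simp
      show "1 / 2 ^ sum b (insert i S - T) \<le> ?\<eta> k" if "k \<in> insert i S"
      proof (cases "k = i")
        case True
        have "1 / 2 ^ sum b (S - T) / 2 ^ b i \<le> \<eta> j / 2 ^ b i"
          by (intro divide_right_mono \<eta>(4) j) simp
        then show ?thesis using True sm by (simp add: power_add mult.commute)
      next
        case False
        have "1 / 2 ^ sum b (insert i S - T) \<le> 1 / (2::real) ^ sum b (S - T)"
          using sm by (intro divide_left_mono power_increasing) auto
        also have "\<dots> \<le> \<eta> k" using \<eta>(4) that False by simp
        finally show ?thesis using False by simp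
      qed
      show "2 * ?\<eta> k \<le> (\<Sum>j\<in>UNIV. B k j * ?\<eta> j)" if k: "k \<in> insert i S - T"
      proof (cases "k = i")
        case True
        have "2 * ?\<eta> k = 2 / 2 ^ b i * \<eta> j" using True by simp
        also have "\<dots> \<le> B i j * \<eta> j" using \<eta>(1) B_ge[OF Bij] by (intro mult_right_mono) auto
        also have "\<dots> = B i j * ?\<eta> j" using \<open>i \<noteq> j\<close> by simp
        also have "\<dots> \<le> (\<Sum>j\<in>UNIV. B i j * ?\<eta> j)" using nn by (intro B_le_sum)
        finally show ?thesis using True by simp
      next
        case False
        then have "2 * ?\<eta> k \<le> (\<Sum>j\<in>UNIV. B k j * \<eta> j)" using \<eta>(5)[of k] k by simp
        also have "\<dots> \<le> (\<Sum>j\<in>UNIV. B k j * ?\<eta> j)"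
          using le B_nonneg by (intro sum_mono mult_left_mono)
        finally show ?thesis .
      qed
    qed
  qed (rule that)
  then obtain \<eta> where \<eta>: "\<forall>i. 0 \<le> \<eta> i \<and> \<eta> i \<le> 1 \<and> (i \<notin> S \<longrightarrow> \<eta> i = 0)"
    "\<forall>i\<in>S. 1 / 2 ^ sum b (S - T) \<le> \<eta> i"
    "\<forall>i\<in>S - T. 2 * \<eta> i \<le> (\<Sum>j\<in>UNIV. B i j * \<eta> j)" unfolding \<Phi>_def by auto
  have "sum b (S - T) \<le> nbits" unfolding nbits_def by (rule sum_mono2) auto
  then have "1 / 2 ^ nbits \<le> 1 / (2::real) ^ sum b (S - T)"
    by (intro divide_left_mono power_increasing) auto
  then show thesis using \<eta> S by (intro that[of S \<eta>]) (auto intro: order_trans)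
qed

text \<open>Paths may be long or revisit vertices, but charging \<open>b i\<close> once for each
  vertex of a set bounds the total loss by \<open>nbits\<close>.\<close>

lemma reach_bound:
  assumes edge: "\<And>i j. B i j \<noteq> 0 \<Longrightarrow> u j / 2 ^ b i \<le> u i"
    and u: "\<And>i. (0::real) \<le> u i" and ij: "(i, j) \<in> {(i, j). B i j \<noteq> 0}\<^sup>*"
  shows "u j / 2 ^ nbits \<le> u i"
proof -
  obtain S where S: "{j} \<subseteq> S" "\<forall>i\<in>S. u j / 2 ^ sum b (S - {j}) \<le> u i"
    "\<And>i k. (i, k) \<in> {(i, j). B i j \<noteq> 0} \<Longrightarrow> k \<in> S \<Longrightarrow> i \<in> S"
  proof (rule backward_closed_superset[of "\<lambda>S. \<forall>i\<in>S. u j / 2 ^ sum b (S - {j}) \<le> u i" "{j}"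
        "{(i, j). B i j \<noteq> 0}"])
    fix S i k assume S: "{j} \<subseteq> S" "\<forall>i\<in>S. u j / 2 ^ sum b (S - {j}) \<le> u i" and i: "i \<notin> S"
      and k: "k \<in> S" "(i, k) \<in> {(i, j). B i j \<noteq> 0}"
    have "i \<noteq> j" "finite S" using i S(1) by auto
    then have sm: "sum b (insert i S - {j}) = b i + sum b (S - {j})"
      using i by (simp add: insert_Diff_if)
    have "u j / 2 ^ sum b (insert i S - {j}) = u j / 2 ^ sum b (S - {j}) / 2 ^ b i"
      unfolding sm by (simp add: power_add mult.commute)
    also have "\<dots> \<le> u k / 2 ^ b i" using S k by (intro divide_right_mono) auto
    also have "\<dots> \<le> u i" using edge k by simp
    finally have new: "u j / 2 ^ sum b (insert i S - {j}) \<le> u i" .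
    have mono: "u j / 2 ^ sum b (insert i S - {j}) \<le> u j / 2 ^ sum b (S - {j})"
      unfolding sm using u by (intro divide_left_mono power_increasing) auto
    show "\<forall>x\<in>insert i S. u j / 2 ^ sum b (insert i S - {j}) \<le> u x"
    proof
      fix x assume "x \<in> insert i S"
      then show "u j / 2 ^ sum b (insert i S - {j}) \<le> u x"
        using new S(2) order_trans[OF mono] by blast
    qed
  next
    show "\<forall>i\<in>{j}. u j / 2 ^ sum b ({j} - {j}) \<le> u i" by simp
  qed (rule that)
  have "i \<in> S" using ij
  proof (induction rule: converse_rtrancl_induct)
    case base then show ?case using S(1) by simp
  next
    case (step y z) then show ?case using S(3) by blast
  qed
  have "sum b (S - {j}) \<le> nbits" unfolding nbits_def by (rule sum_mono2) auto
  then have "u j / 2 ^ nbits \<le> u j / 2 ^ sum b (S - {j})"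
    using u by (intro divide_left_mono power_increasing) auto
  also have "\<dots> \<le> u i" using S(2) \<open>i \<in> S\<close> by blast
  finally show ?thesis .
qed

section \<open>Distance of a fixed point from the all-ones vector\<close>

lemma complement_ev:
  assumes "i \<notin> Q"
  shows "1 - ev q i = (1 - c i - (\<Sum>j\<in>UNIV. B i j)) + (\<Sum>j\<in>UNIV. B i j * (1 - q j))"
  using assms by (simp add: ev_def right_diff_distrib sum_subtractf)

lemma fixpoint_gap:
  assumes q: "\<And>i. 0 < q i" "\<And>i. q i < 1" and fp: "\<And>i. ev q i = q i"
  shows "1 / 2 ^ (4 * nbits) \<le> 1 - q i"
proof -
  define u where "u i = 1 - q i" for i
  have u0: "0 < u i" "u i < 1" for i using q by (auto simp: u_def)
  have u0': "0 \<le> u i" for i using u0[of i] by simp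
  have uQ: "u i = (\<Sum>j\<in>UNIV. B i j * u j) - u (l i) * u (r i)" if "i \<in> Q" for i
    using fp[of i] that unfolding sum_B_Q[OF that] by (simp add: ev_def u_def algebra_simps)
  have uL: "u i = (1 - c i - (\<Sum>j\<in>UNIV. B i j)) + (\<Sum>j\<in>UNIV. B i j * u j)" if "i \<notin> Q" for i
    using complement_ev[OF that, of q] fp by (simp add: u_def)
  have edge: "u j / 2 ^ b i \<le> u i" if "B i j \<noteq> 0" for i j
  proof (cases "i \<in> Q")
    case True
    \<comment> \<open>These give \<open>u i >= max (u (l i)) (u (r i))\<close>: nothing is lost
      along the edges of a product.\<close>
    have "u (l i) * u (r i) \<le> u (l i)" "u (l i) * u (r i) \<le> u (r i)"
      by (auto intro!: mult_left_le mult_left_le_one_le simp: u0 u0' less_imp_le)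
    moreover have "u i = u (l i) + u (r i) - u (l i) * u (r i)"
      using uQ[OF True] sum_B_Q[OF True] by simp
    moreover have "j = l i \<or> j = r i" using that B_Q[OF True] by (auto simp: of_bool_def split: if_splits)
    ultimately have "u j \<le> u i" using u0'[of "l i"] u0'[of "r i"] by auto
    moreover have "u j / 2 ^ b i \<le> u j / 1" using u0' by (intro divide_left_mono) auto
    ultimately show ?thesis by simp
  next
    case False
    have "u j / 2 ^ b i \<le> 2 / 2 ^ b i * u j" using u0'[of j] by (simp add: field_simps)
    also have "\<dots> \<le> B i j * u j" using B_ge[OF that] u0' by (intro mult_right_mono) auto
    also have "\<dots> \<le> (\<Sum>j\<in>UNIV. B i j * u j)" using u0' by (intro B_le_sum)
    also have "\<dots> \<le> u i" using uL[OF False] sum_le_1[OF False] by simp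
    finally show ?thesis .
  qed
  note reach = reach_bound[of u, OF edge u0']
  obtain i0 where i0: "\<And>i. u i0 \<le> u i"
    using ex_min_if_finite[of "range u"] by (auto simp: not_less)
  define m where "m = u i0"
  have m: "0 < m" using u0 by (simp add: m_def)
  \<comment> \<open>Reachable vertices are closed under successors, so row sums over
    \<open>S\<close> are complete, and \<open>u\<close> is at most \<open>2 ^ nbits * m\<close> on
    them.\<close>
  define S where "S = {j. (i0, j) \<in> {(i, j). B i j \<noteq> 0}\<^sup>*}"
  have S_closed: "j \<in> S" if "i \<in> S" "B i j \<noteq> 0" for i j
    using that unfolding S_def by (auto intro: rtrancl_into_rtrancl)
  have i0S: "i0 \<in> S" by (simp add: S_def)
  have uS: "u j \<le> 2 ^ nbits * m" if "j \<in> S" for j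
    using reach[of i0 j] that by (simp add: S_def m_def field_simps)
  have "1 \<le> 2 ^ (4 * nbits) * m"
  proof (cases "S \<inter> deficient = {}")
    \<comment> \<open>A reachable deficient equation bounds its own \<open>u t\<close> below by its
      deficit, and this bound travels back to the minimiser.\<close>
    case False
    then obtain t where t: "t \<in> S" "t \<in> deficient" by auto
    have "1 / 2 ^ nbits \<le> 1 / (2::real) ^ b t" by (rule inverse_power_nbits_le)
    also have "\<dots> \<le> 1 - c t - (\<Sum>j\<in>UNIV. B t j)"
      using t deficit_ge by (simp add: deficient_def)
    also have "\<dots> \<le> u t" using t uL[of t] u0' B_nonneg by (auto simp: deficient_def intro!: sum_nonneg)
    also have "\<dots> \<le> 2 ^ nbits * m" by (rule uS[OF t(1)])
    finally have "1 \<le> 2 ^ (nbits + nbits) * m" by (simp add: field_simps power_add)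
    also have "\<dots> \<le> 2 ^ (4 * nbits) * m" using m by (intro mult_right_mono power_increasing) auto
    finally show ?thesis .
  next
    case True
    \<comment> \<open>On \<open>S\<close>, where no equation is deficient, \<open>B u - u\<close> is
      exactly this second-order term.\<close>
    define g where "g i = (if i \<in> Q then u (l i) * u (r i) else 0)" for i
    have ueq: "(\<Sum>j\<in>UNIV. B i j * u j) - u i = g i" if "i \<in> S" for i
      using uQ[of i] uL[of i] that True by (auto simp: g_def deficient_def)
    have sumS: "(\<Sum>j\<in>S. B i j * u j) = (\<Sum>j\<in>UNIV. B i j * u j)" if "i \<in> S" for i
      using that S_closed by (intro sum.mono_neutral_left) auto
    have g0: "0 \<le> g i" for i using u0' by (simp add: g_def)
    obtain w v where w: "\<And>i. 0 \<le> w i" "0 < w v" "\<And>i. 0 < w i \<Longrightarrow> i \<in> S"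
      "\<And>i. w i \<le> (\<Prod>i\<in>UNIV. 2 ^ b i)" "\<And>j. w j \<le> (\<Sum>i\<in>UNIV. w i * B i j)"
      "\<And>j. (\<Sum>i\<in>UNIV. w i * B i j) - w j \<in> \<int>"
    proof (rule supercritical_left_vector[of B S u D "\<lambda>i. 2 ^ b i"])
      show "u i \<le> (\<Sum>j\<in>S. B i j * u j)" if "i \<in> S" for i
        using ueq[OF that] g0[of i] sumS[OF that] by simp
    qed (use B_nonneg i0S u0 D_int D_ge DB_int D_le in auto)
    have w_le: "w i \<le> 2 ^ nbits" for i using w(4)[of i] by (simp add: nbits_def power_sum)
    define h where "h j = (\<Sum>i\<in>UNIV. w i * B i j) - w j" for j
    have h0: "0 \<le> h j" for j using w(5) by (simp add: h_def)
    have hu: "(\<Sum>j\<in>UNIV. h j * u j) = (\<Sum>i\<in>UNIV. w i * g i)"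
    proof -
      have "(\<Sum>j\<in>UNIV. h j * u j) = (\<Sum>j\<in>UNIV. \<Sum>i\<in>UNIV. w i * B i j * u j) - (\<Sum>i\<in>UNIV. w i * u i)"
        by (simp add: h_def left_diff_distrib sum_subtractf sum_distrib_right)
      also have "\<dots> = (\<Sum>i\<in>UNIV. w i * ((\<Sum>j\<in>UNIV. B i j * u j) - u i))"
        by (subst sum.swap) (simp add: right_diff_distrib sum_subtractf sum_distrib_left mult.assoc)
      also have "\<dots> = (\<Sum>i\<in>UNIV. w i * g i)"
      proof (intro sum.cong refl)
        fix i
        show "w i * ((\<Sum>j\<in>UNIV. B i j * u j) - u i) = w i * g i"
          using w(1)[of i] w(3)[of i] ueq[of i] by (cases "w i = 0") auto
      qed
      finally show ?thesis .
    qed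
    \<comment> \<open>If \<open>w B = w\<close>, then \<open>hu\<close> keeps the support
      \<open>W\<close> of \<open>w\<close> away from products, invariance closes \<open>W\<close>
      under successors, and comparing total mass forces row sums 1, hence zero constants: a set
      excluded by \<open>no_trap\<close>.\<close>
    have "\<exists>j. h j \<noteq> 0"
    proof (rule ccontr)
      assume "\<not> (\<exists>j. h j \<noteq> 0)"
      then have h: "h j = 0" for j by simp
      define W where "W = {i. 0 < w i}"
      have WS: "W \<subseteq> S" using w(3) by (auto simp: W_def)
      have "(\<Sum>i\<in>UNIV. w i * g i) = 0" using hu h by simp
      then have wg: "w i * g i = 0" for i
        using w(1) g0 by (subst (asm) sum_nonneg_eq_0_iff) auto
      have WQ: "W \<inter> Q = {}"
      proof -
        have False if "i \<in> W" "i \<in> Q" for i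
          using wg[of i] that u0[of "l i"] u0[of "r i"] by (auto simp: W_def g_def)
        then show ?thesis by blast
      qed
      have W_closed: "j \<in> W" if "i \<in> W" "B i j \<noteq> 0" for i j
      proof -
        have "0 < w i * B i j" using that B_nonneg[of i j] by (simp add: W_def)
        also have "\<dots> \<le> (\<Sum>i\<in>UNIV. w i * B i j)"
          by (rule member_le_sum) (auto simp: w(1) B_nonneg)
        also have "\<dots> = w j" using h[of j] by (simp add: h_def)
        finally show ?thesis by (simp add: W_def)
      qed
      have "(\<Sum>i\<in>UNIV. w i * (1 - (\<Sum>j\<in>UNIV. B i j))) = - (\<Sum>j\<in>UNIV. h j)"
      proof -
        have "(\<Sum>j\<in>UNIV. h j) = (\<Sum>j\<in>UNIV. \<Sum>i\<in>UNIV. w i * B i j) - (\<Sum>j\<in>UNIV. w j)"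
          by (simp add: h_def sum_subtractf)
        then show ?thesis
          by (subst (asm) sum.swap) (simp add: right_diff_distrib sum_subtractf sum_distrib_left)
      qed
      then have z: "(\<Sum>i\<in>UNIV. w i * (1 - (\<Sum>j\<in>UNIV. B i j))) = 0" using h by simp
      have "0 \<le> w i * (1 - (\<Sum>j\<in>UNIV. B i j))" for i
      proof (cases "i \<in> W")
        case True
        then have "i \<notin> Q" using WQ by blast
        then show ?thesis using sum_le_1[of i] c_nonneg[of i] w(1)[of i]
          by (intro mult_nonneg_nonneg) auto
      next
        case False then show ?thesis using w(1)[of i] by (simp add: W_def)
      qed
      then have row: "w i * (1 - (\<Sum>j\<in>UNIV. B i j)) = 0" for i
        using z by (subst (asm) sum_nonneg_eq_0_iff) auto
      have c0: "c i = 0" if "i \<in> W" for i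
      proof -
        have "(\<Sum>j\<in>UNIV. B i j) = 1" using row[of i] that by (simp add: W_def)
        moreover have "i \<notin> Q" using that WQ by blast
        ultimately show ?thesis using sum_le_1[of i] c_nonneg[of i] by auto
      qed
      have "v \<in> W" using w(2) by (simp add: W_def)
      then show False using no_trap[of W] WQ c0 W_closed by blast
    qed
    then obtain j where j: "h j \<noteq> 0" by auto
    have "h j \<in> \<int>" using w(6) by (simp add: h_def)
    then have h1: "1 \<le> h j" using j h0[of j] Ints_nonzero_abs_ge1[of "h j"] by simp
    have "m \<le> 1 * u j" using i0 by (simp add: m_def)
    also have "\<dots> \<le> h j * u j" using h1 u0' by (intro mult_right_mono)
    also have "\<dots> \<le> (\<Sum>j\<in>UNIV. h j * u j)"
      by (rule member_le_sum) (auto simp: h0 u0')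
    also have "\<dots> = (\<Sum>i\<in>UNIV. w i * g i)" by (rule hu)
    \<comment> \<open>Three factors \<open>2 ^ nbits\<close> come from \<open>w\<close> and two
      values of \<open>u\<close>, the fourth from the number of vertices; hence the exponent
      \<open>4 * nbits\<close>.\<close>
    also have "\<dots> \<le> (\<Sum>i\<in>(UNIV::'n set). 2 ^ nbits * (2 ^ nbits * m * (2 ^ nbits * m)))"
    proof (rule sum_mono)
      fix i :: 'n
      have sq: "0 \<le> 2 ^ nbits * (2 ^ nbits * m * (2 ^ nbits * m))" using m by simp
      show "w i * g i \<le> 2 ^ nbits * (2 ^ nbits * m * (2 ^ nbits * m))"
      proof (cases "w i = 0 \<or> i \<notin> Q")
        case True then show ?thesis using sq by (auto simp: g_def)
      next
        case False
        then have iS: "i \<in> S" "i \<in> Q" using w(1)[of i] w(3)[of i] by auto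
        have "l i \<in> S" "r i \<in> S" using iS S_closed[OF iS(1)] B_Q[OF iS(2)] by auto
        then have "g i \<le> 2 ^ nbits * m * (2 ^ nbits * m)"
          using uS u0' m iS by (auto simp: g_def intro!: mult_mono)
        then show ?thesis using w_le[of i] w(1)[of i] g0[of i] by (intro mult_mono) auto
      qed
    qed
    also have "\<dots> = real CARD('n) * 2 ^ (3 * nbits) * m * m"
      by (simp add: numeral_3_eq_3 power_add mult_ac)
    also have "\<dots> \<le> 2 ^ nbits * 2 ^ (3 * nbits) * m * m"
    proof -
      have "real CARD('n) \<le> real nbits" using card_le_nbits by simp
      also have "\<dots> \<le> 2 ^ nbits" by (rule less_imp_le[OF of_nat_less_two_power])
      finally show ?thesis using m by (intro mult_right_mono) auto
    qed
    also have "\<dots> = 2 ^ (4 * nbits) * m * m" by (simp add: power_add[symmetric])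
    finally show ?thesis using m by simp
  qed
  then have "1 / 2 ^ (4 * nbits) \<le> m" by (simp add: field_simps)
  also have "\<dots> \<le> u i" unfolding m_def by (rule i0)
  finally show ?thesis by (simp add: u_def)
qed

section \<open>Pre-fixed points near an approximate fixed point\<close>

text \<open>Errors are allowed only at affine equations of total weight 1, which have no slack of
  their own; the potential lends them slack from products and deficient equations. The exponent 14
  splits into 8 for \<open>\<beta>\<close>, 1 for the least value of \<open>\<eta>\<close> and 5 for
  \<open>t\<close>.\<close>

lemma stability:
  assumes q: "\<And>i. 0 < q i" and gap: "\<And>i. 1 / 2 ^ (4 * nbits) \<le> 1 - q i"
    and \<epsilon>: "0 \<le> \<epsilon>" "\<epsilon> \<le> 1"
    and ge: "\<And>i. q i \<le> ev q i" and le: "\<And>i. ev q i \<le> q i + \<epsilon> / 2 ^ (14 * nbits + 3)"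
    and exact: "\<And>i. i \<in> Q \<union> deficient \<Longrightarrow> ev q i = q i"
  obtains z where "\<And>i. q i \<le> z i" "\<And>i. z i \<le> q i + \<epsilon>" "\<And>i. z i \<le> 1" "\<And>i. ev z i \<le> z i"
proof -
  define X :: real where "X = 2 ^ nbits"
  have X: "2 \<le> X" using power_increasing[OF nbits_pos, of "2::real"] by (simp add: X_def)
  then have X0: "0 < X" by simp
  have pows: "(2::real) ^ (4 * nbits) = X ^ 4" "(2::real) ^ (14 * nbits + 3) = 8 * X ^ 14"
    by (simp_all add: X_def power_mult[symmetric] mult.commute power_add)
  define u where "u i = 1 - q i" for i
  define d where "d i = 1 - c i - (\<Sum>j\<in>UNIV. B i j)" for i
  define e where "e i = ev q i - q i" for i
  have u_ge: "1 / X ^ 4 \<le> u i" for i using gap[of i] pows by (simp add: u_def)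
  have u0: "0 < u i" for i by (rule less_le_trans[OF _ u_ge]) (use X0 in simp)
  have u0': "0 \<le> u i" for i using u0[of i] by simp
  have u1: "u i < 1" for i using q[of i] by (simp add: u_def)
  have e: "0 \<le> e i" "e i \<le> \<epsilon> / (8 * X ^ 14)" for i
    using ge[of i] le[of i] pows by (auto simp: e_def)
  have uL: "u i = d i + (\<Sum>j\<in>UNIV. B i j * u j) + e i" if "i \<notin> Q" for i
    using complement_ev[OF that, of q] by (simp add: u_def d_def e_def)
  note potential = potential[folded X_def]
  obtain S \<eta> where S: "Q \<union> deficient \<subseteq> S"
    and \<eta>: "\<And>i. 0 \<le> \<eta> i" "\<And>i. \<eta> i \<le> 1" "\<And>i. i \<in> S \<Longrightarrow> 1 / X \<le> \<eta> i"
    and step: "\<And>i. i \<in> S \<Longrightarrow> i \<notin> Q \<union> deficient \<Longrightarrow> 2 * \<eta> i \<le> (\<Sum>j\<in>UNIV. B i j * \<eta> j)"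
    and bwd: "\<And>i j. B i j \<noteq> 0 \<Longrightarrow> j \<in> S \<Longrightarrow> i \<in> S"
    by (rule potential[of "Q \<union> deficient"]) (rule that)
  \<comment> \<open>Off \<open>S\<close> lies a successor-closed block of affine equations of total
    weight 1. A strict supersolution \<open>v\<close> there bounds some \<open>u k\<close> by
    \<open>X\<^sup>2 * e k\<close>, which contradicts the gap \<open>1 / X ^ 4\<close>.\<close>
  have "S = UNIV"
  proof (rule ccontr)
    define N where "N = - S"
    assume "S \<noteq> UNIV"
    then have N: "N \<noteq> {}" by (auto simp: N_def)
    have N_closed: "j \<in> N" if "i \<in> N" "B i j \<noteq> 0" for i j using that bwd by (auto simp: N_def)
    have NQ: "i \<notin> Q" "c i + (\<Sum>j\<in>UNIV. B i j) = 1" if "i \<in> N" for i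
      using that S by (auto simp: N_def deficient_def)
    define T where "T = {i \<in> N. c i \<noteq> 0}"
    obtain S2 \<zeta> where S2: "T \<subseteq> S2"
      and \<zeta>: "\<And>i. 0 \<le> \<zeta> i" "\<And>i. \<zeta> i \<le> 1" "\<And>i. i \<in> S2 \<Longrightarrow> 1 / X \<le> \<zeta> i"
      and step2: "\<And>i. i \<in> S2 \<Longrightarrow> i \<notin> T \<Longrightarrow> 2 * \<zeta> i \<le> (\<Sum>j\<in>UNIV. B i j * \<zeta> j)"
      and bwd2: "\<And>i j. B i j \<noteq> 0 \<Longrightarrow> j \<in> S2 \<Longrightarrow> i \<in> S2"
      by (rule potential[of T]) (rule that)
    have NS2: "N \<subseteq> S2"
    proof (rule ccontr)
      assume "\<not> N \<subseteq> S2"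
      then have "N - S2 \<noteq> {}" "(N - S2) \<inter> Q = {}" using NQ by auto
      from no_trap[OF this] obtain i
        where i: "i \<in> N" "i \<notin> S2" "c i \<noteq> 0 \<or> (\<exists>j. B i j \<noteq> 0 \<and> j \<notin> N - S2)" by auto
      then show False using S2 bwd2 N_closed by (auto simp: T_def)
    qed
    \<comment> \<open>Dividing by \<open>X\<close> keeps \<open>v\<close> positive and makes
      \<open>\<zeta> i / X\<close> at most \<open>1 / X\<close>, half of what the constant provides
      on \<open>T\<close>; off \<open>T\<close> the doubling of \<open>\<zeta>\<close> gives the
      decrease.\<close>
    define v where "v i = 1 - \<zeta> i / X" for i
    have v: "0 < v i" "v i \<le> 1" for i
      using \<zeta>(1)[of i] \<zeta>(2)[of i] X by (auto simp: v_def field_simps)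
    have decay: "(\<Sum>j\<in>UNIV. B i j * v j) \<le> v i - 1 / X\<^sup>2" if i: "i \<in> N" for i
    proof -
      have Bv: "(\<Sum>j\<in>UNIV. B i j * v j) = 1 - c i - (\<Sum>j\<in>UNIV. B i j * \<zeta> j) / X"
        using NQ(2)[OF i]
        by (simp add: v_def right_diff_distrib sum_subtractf sum_divide_distrib)
      have XX: "1 / X\<^sup>2 \<le> 1 / X" using X by (simp add: power2_eq_square field_simps)
      show ?thesis
      proof (cases "i \<in> T")
        case True
        have "2 / X \<le> 2 / 2 ^ b i" using inverse_power_nbits_le[of i] by (simp add: X_def)
        also have "\<dots> \<le> c i" using True c_ge[of i] NQ(1)[OF i] by (simp add: T_def)
        finally have "2 / X \<le> c i" .
        moreover have "0 \<le> (\<Sum>j\<in>UNIV. B i j * \<zeta> j) / X"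
          using \<zeta>(1) B_nonneg X0 by (intro divide_nonneg_pos sum_nonneg mult_nonneg_nonneg) auto
        moreover have "\<zeta> i / X \<le> 1 / X" using \<zeta>(2) X0 by (intro divide_right_mono) auto
        moreover have "2 / X = 1 / X + 1 / X" by simp
        ultimately show ?thesis unfolding Bv unfolding v_def using XX by linarith
      next
        case False
        have iS: "i \<in> S2" using NS2 i by auto
        have "2 * \<zeta> i / X \<le> (\<Sum>j\<in>UNIV. B i j * \<zeta> j) / X"
          using step2[OF iS False] X0 by (intro divide_right_mono) auto
        moreover have "1 / X / X \<le> \<zeta> i / X"
          using \<zeta>(3)[OF iS] X0 by (intro divide_right_mono) auto
        moreover have "c i = 0" using False i by (simp add: T_def)
        ultimately show ?thesis unfolding Bv unfolding v_def by (simp add: power2_eq_square)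
      qed
    qed
    have "finite N" by simp
    define f where "f k = u k / v k" for k
    \<comment> \<open>Maximum principle for \<open>u / v\<close>: at the maximiser \<open>k\<close>,
      the strict decrease of \<open>v\<close> must be made up by the error
      \<open>e k\<close>.\<close>
    obtain k where k: "k \<in> N" "\<And>i. i \<in> N \<Longrightarrow> f i \<le> f k"
      using finite_imageI[OF \<open>finite N\<close>, of f] N Max_in[of "f ` N"] Max_ge[of "f ` N"]
      by (metis (no_types, lifting) empty_is_image imageE imageI)
    have f0: "0 \<le> f k" using u0 v by (simp add: f_def less_imp_le)
    have uf: "u i = f i * v i" for i using v(1)[of i] by (simp add: f_def)
    have "(\<Sum>j\<in>UNIV. B k j * u j) \<le> (\<Sum>j\<in>UNIV. f k * (B k j * v j))"
    proof (rule sum_mono)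
      fix j
      show "B k j * u j \<le> f k * (B k j * v j)"
      proof (cases "B k j = 0")
        case False
        then have "u j \<le> f k * v j" unfolding uf[of j]
          using k N_closed v(1)[of j] by (intro mult_right_mono) auto
        then have "B k j * u j \<le> B k j * (f k * v j)" using B_nonneg by (rule mult_left_mono)
        then show ?thesis by (simp add: mult_ac)
      qed simp
    qed
    also have "\<dots> \<le> f k * (v k - 1 / X\<^sup>2)"
      unfolding sum_distrib_left[symmetric] by (intro mult_left_mono decay k f0)
    finally have "f k / X\<^sup>2 \<le> e k"
      using uL[of k] NQ[OF k(1)] uf[of k] by (simp add: d_def right_diff_distrib)
    moreover have "u k \<le> f k" unfolding uf[of k] using f0 v by (intro mult_left_le) auto
    ultimately have "u k / X\<^sup>2 \<le> e k" using X0 by (meson divide_right_mono order_trans zero_le_power2)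
    moreover have "1 / X ^ 4 / X\<^sup>2 \<le> u k / X\<^sup>2" using u_ge by (intro divide_right_mono) auto
    moreover have "\<epsilon> / (8 * X ^ 14) \<le> 1 / (8 * X ^ 14)"
      using \<epsilon> X0 by (intro divide_right_mono) auto
    ultimately have "1 / X ^ 4 / X\<^sup>2 \<le> 1 / (8 * X ^ 14)" using e(2)[of k] by linarith
    then have "8 * X ^ 14 \<le> X ^ 6"
      using X0 by (simp add: field_simps power_add[symmetric])
    moreover have "X ^ 6 \<le> X ^ 14" using X by (intro power_increasing) auto
    moreover have "0 < X ^ 14" using X0 by simp
    ultimately show False by linarith
  qed
  define \<beta> where "\<beta> = 1 / (2 * X ^ 8)"
  define t where "t = \<epsilon> / (4 * X ^ 5)"
  have \<beta>0: "0 < \<beta>" using X0 by (simp add: \<beta>_def)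
  have pow1: "1 \<le> X ^ n" for n using X by simp
  have t: "0 \<le> t" "t \<le> 1 / 2" "t \<le> \<epsilon>"
  proof -
    show "0 \<le> t" using X0 \<epsilon> by (simp add: t_def)
    have "t \<le> \<epsilon> / 2"
      unfolding t_def using pow1[of 5] X0 \<epsilon> by (intro divide_left_mono) auto
    then show "t \<le> 1 / 2" "t \<le> \<epsilon>" using \<epsilon> by auto
  qed
  have \<beta>\<eta>: "0 \<le> \<beta> * \<eta> i" "\<beta> * \<eta> i \<le> \<beta>" for i
    using \<beta>0 \<eta> by (auto intro: mult_left_le)
  define v where "v i = u i - \<beta> * \<eta> i" for i
  have "\<beta> \<le> 1 / X ^ 4"
  proof -
    have "X ^ 4 \<le> X ^ 8" using X by (intro power_increasing) auto
    then have "X ^ 4 \<le> 2 * X ^ 8" using pow1[of 8] by linarith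
    then show ?thesis unfolding \<beta>_def using X0 by (intro divide_left_mono) auto
  qed
  then have v: "0 \<le> v i" "v i \<le> u i" for i
    using \<beta>\<eta>[of i] u_ge[of i] by (auto simp: v_def)
  define z where "z i = q i + t * v i" for i
  have ev_z: "ev z i \<le> z i" for i
  proof (cases "i \<in> Q")
    case True
    let ?l = "l i" and ?r = "r i"
    have qi: "q i = q ?l * q ?r" using exact[of i] True by (simp add: ev_def)
    \<comment> \<open>The first-order terms leave \<open>u ?l * u ?r\<close> unspent: one half
      covers the quadratic term, the other covers \<open>\<beta> * \<eta> i\<close>.\<close>
    have "q ?l * v ?r + q ?r * v ?l \<le> q ?l * u ?r + q ?r * u ?l"
      using v q by (intro add_mono mult_left_mono) (auto simp: less_imp_le)
    also have "\<dots> = u i - u ?l * u ?r" by (simp add: u_def qi algebra_simps)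
    finally have 1: "q ?l * v ?r + q ?r * v ?l \<le> u i - u ?l * u ?r" .
    have "t * (v ?l * v ?r) \<le> 1 / 2 * (u ?l * u ?r)"
      using t v u0' by (intro mult_mono) auto
    moreover have "\<beta> * \<eta> i \<le> 1 / 2 * (u ?l * u ?r)"
    proof -
      have "1 / X ^ 4 * (1 / X ^ 4) \<le> u ?l * u ?r"
        using u_ge u0' X0 by (intro mult_mono) auto
      then have "2 * \<beta> \<le> u ?l * u ?r" by (simp add: \<beta>_def power_add[symmetric])
      then show ?thesis using \<beta>\<eta>(2)[of i] by simp
    qed
    ultimately have "q ?l * v ?r + q ?r * v ?l + t * (v ?l * v ?r) \<le> v i"
      using 1 by (simp add: v_def)
    then have "t * (q ?l * v ?r + q ?r * v ?l + t * (v ?l * v ?r)) \<le> t * v i"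
      using t by (intro mult_left_mono)
    then show ?thesis using True qi by (simp add: ev_def z_def algebra_simps)
  next
    case False
    have "ev z i = ev q i + t * (\<Sum>j\<in>UNIV. B i j * v j)"
      using False by (simp add: ev_def z_def distrib_left sum.distrib sum_distrib_left mult_ac)
    also have "(\<Sum>j\<in>UNIV. B i j * v j) = u i - d i - e i - \<beta> * (\<Sum>j\<in>UNIV. B i j * \<eta> j)"
      using uL[OF False]
      by (simp add: v_def right_diff_distrib sum_subtractf sum_distrib_left mult_ac)
    finally have evz: "ev z i = q i + e i + t * (u i - d i - e i - \<beta> * (\<Sum>j\<in>UNIV. B i j * \<eta> j))"
      by (simp add: e_def)
    \<comment> \<open>Slack must pay for the left-hand side. A deficient equation pays with
      \<open>d i\<close> and has no error; elsewhere one half of the doubled potential covers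
      \<open>\<eta> i\<close> and the other half covers the error.\<close>
    have "e i + t * (\<beta> * \<eta> i) \<le> t * (d i + e i + \<beta> * (\<Sum>j\<in>UNIV. B i j * \<eta> j))"
    proof (cases "i \<in> deficient")
      case True
      have "\<beta> \<le> 1 / X"
      proof -
        have "X ^ 1 \<le> X ^ 8" using X by (intro power_increasing) auto
        then have "X \<le> 2 * X ^ 8" using pow1[of 8] by simp
        then show ?thesis unfolding \<beta>_def using X0 by (intro divide_left_mono) auto
      qed
      also have "\<dots> \<le> d i" using inverse_power_nbits_le[of i] deficit_ge[of i] True
        by (auto simp: X_def d_def deficient_def)
      finally have "\<beta> * \<eta> i \<le> d i" using \<beta>\<eta>(2)[of i] by simp
      moreover have "0 \<le> \<beta> * (\<Sum>j\<in>UNIV. B i j * \<eta> j)"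
        using \<beta>0 \<eta> B_nonneg by (intro mult_nonneg_nonneg sum_nonneg) auto
      moreover have "e i = 0" using exact[of i] True by (simp add: e_def)
      ultimately show ?thesis using t(1) by (simp add: mult_left_mono)
    next
      case nd: False
      have "2 * \<eta> i \<le> (\<Sum>j\<in>UNIV. B i j * \<eta> j)" using step \<open>S = UNIV\<close> False nd by simp
      then have "\<beta> * (2 * \<eta> i) \<le> \<beta> * (\<Sum>j\<in>UNIV. B i j * \<eta> j)" using \<beta>0 by (intro mult_left_mono) auto
      moreover have "d i = 0" using False nd by (simp add: d_def deficient_def)
      ultimately have "2 * (\<beta> * \<eta> i) \<le> d i + e i + \<beta> * (\<Sum>j\<in>UNIV. B i j * \<eta> j)"
        using e(1)[of i] by simp
      then have A: "t * (2 * (\<beta> * \<eta> i)) \<le> t * (d i + e i + \<beta> * (\<Sum>j\<in>UNIV. B i j * \<eta> j))"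
        using t(1) by (rule mult_left_mono)
      have "X ^ 14 = X ^ 5 * X ^ 8 * X ^ 1" unfolding power_add[symmetric] by simp
      then have "\<epsilon> / (8 * X ^ 14) = t * (\<beta> * (1 / X))" by (simp add: t_def \<beta>_def)
      also have "\<dots> \<le> t * (\<beta> * \<eta> i)"
        using \<eta>(3)[of i] \<open>S = UNIV\<close> t(1) \<beta>0 by (intro mult_left_mono) auto
      finally show ?thesis using A e(2)[of i] by simp
    qed
    then have "ev z i \<le> q i + t * u i - t * (\<beta> * \<eta> i)"
      unfolding evz by (simp add: algebra_simps)
    then show ?thesis by (simp add: z_def v_def right_diff_distrib)
  qed
  show thesis
  proof (rule that[of z])
    fix i
    show "q i \<le> z i" using t v by (simp add: z_def)
    have "t * v i \<le> t * 1" using t v(2)[of i] u1[of i] by (intro mult_left_mono) auto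
    then show "z i \<le> q i + \<epsilon>" using t by (simp add: z_def)
    have "t * v i \<le> 1 * u i" using t v[of i] by (intro mult_mono) auto
    then show "z i \<le> 1" by (simp add: z_def u_def)
    show "ev z i \<le> z i" by (rule ev_z)
  qed
qed

end

section \<open>Encoding size and pre-fixed points\<close>

lemma nat_bitlen:
  assumes "0 < x"
  shows "1 \<le> nat (bitlen x)" "x < 2 ^ nat (bitlen x)"
  using assms bitlen_bounds[OF assms] bitlen_nonneg[of x] bitlen_eq_zero_iff[of x] by auto

abbreviation den :: "rat \<Rightarrow> int" where "den r \<equiv> snd (quotient_of r)"

lemma den_pos: "0 < den r"
  using quotient_of_denom_pos[of r "fst (quotient_of r)"] by simp

lemma rat_times_den: "real_of_rat r * of_int (den r) = of_int (fst (quotient_of r))"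
proof -
  have "r = of_int (fst (quotient_of r)) / of_int (den r)"
    using quotient_of_div[of r "fst (quotient_of r)" "den r"] by simp
  then have "real_of_rat r = of_int (fst (quotient_of r)) / of_int (den r)"
    by (metis of_rat_divide of_rat_of_int_eq)
  then show ?thesis using den_pos[of r] by simp
qed

lemma times_den_Ints: "real_of_rat r * of_int (den r) \<in> \<int>"
  by (simp add: rat_times_den)

text \<open>A positive numerator takes at least one bit besides those of the denominator; that bit
  is the factor 2 in both bounds.\<close>

lemma
  assumes "0 < r"
  shows den_le_bits: "2 * real_of_int (den r) \<le> 2 ^ rat_bits r"
    and rat_ge_bits: "2 / 2 ^ rat_bits r \<le> real_of_rat r"
proof -
  have d: "0 < real_of_int (den r)" using den_pos[of r] by simp
  have "0 < real_of_int (fst (quotient_of r))"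
    using assms d by (simp flip: rat_times_den)
  then have p: "1 \<le> fst (quotient_of r)" by simp
  have "den r \<le> 2 ^ nat (bitlen (den r))" using nat_bitlen(2)[OF den_pos[of r]] by simp
  then have "real_of_int (den r) \<le> 2 ^ nat (bitlen (den r))" by simp
  then have "2 ^ 1 * real_of_int (den r)
      \<le> 2 ^ nat (bitlen (fst (quotient_of r))) * 2 ^ nat (bitlen (den r))"
    using nat_bitlen(1)[of "fst (quotient_of r)"] p d
    by (intro mult_mono power_increasing) auto
  then show le: "2 * real_of_int (den r) \<le> 2 ^ rat_bits r"
    by (simp add: rat_bits_def power_add split_beta)
  have "2 / 2 ^ rat_bits r \<le> 1 / real_of_int (den r)"
    using le d by (simp add: field_simps)
  also have "\<dots> \<le> real_of_int (fst (quotient_of r)) / of_int (den r)"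
    using p d by (intro divide_right_mono) auto
  also have "\<dots> = real_of_rat r" using rat_times_den[of r] d by (simp add: field_simps)
  finally show "2 / 2 ^ rat_bits r \<le> real_of_rat r" .
qed

lemma var_bits_ge: "1 \<le> var_bits TYPE('n::finite)"
  unfolding var_bits_def by (rule nat_bitlen) simp

text \<open>The definition compares only with fixed points. Knaster--Tarski on the box below
  \<open>z\<close> supplies a fixed point under each pre-fixed point.\<close>

lemma least_fixpoint_le:
  assumes P: "minPPS_SNF P" and z: "z \<in> {0..1}" "eval_sys P z \<le> z"
  shows "least_fixpoint P \<le> z"
proof -
  define A where "A = {x. 0 \<le> x \<and> x \<le> z \<and> eval_sys P x \<le> x}"
  define q where "q = (\<chi> i. INF x\<in>A. x $ i)"
  have zA: "z \<in> A" using z by (simp add: A_def)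
  have bdd: "bdd_below ((\<lambda>x. x $ i) ` A)" for i
    by (rule bdd_belowI[of _ 0]) (auto simp: A_def less_eq_vec_def)
  have lower: "q \<le> x" if "x \<in> A" for x
    using that bdd by (auto simp: q_def less_eq_vec_def intro!: cINF_lower)
  have greatest: "y \<le> q" if "\<And>x. x \<in> A \<Longrightarrow> y \<le> x" for y
    using that zA by (auto simp: q_def less_eq_vec_def intro!: cINF_greatest)
  have q0: "0 \<le> q" by (rule greatest) (auto simp: A_def)
  have qz: "q \<le> z" by (rule lower[OF zA])
  have le: "eval_sys P q \<le> q"
  proof (rule greatest)
    fix x assume x: "x \<in> A"
    have "eval_sys P q \<le> eval_sys P x" by (rule eval_sys_mono[OF P q0 lower[OF x]])
    also have "\<dots> \<le> x" using x by (simp add: A_def)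
    finally show "eval_sys P q \<le> x" .
  qed
  have "0 \<le> eval_sys P 0"
    using P by (auto simp: minPPS_SNF_def eval_sys_def less_eq_vec_def
        intro: eval_eqn_bounds(1))
  also have "\<dots> \<le> eval_sys P q" by (rule eval_sys_mono[OF P order_refl q0])
  finally have nn: "0 \<le> eval_sys P q" .
  have "eval_sys P q \<in> A"
    using nn le qz eval_sys_mono[OF P nn le] by (auto simp: A_def)
  then have "q \<le> eval_sys P q" by (rule lower)
  with le have "eval_sys P q = q" by simp
  moreover have "q \<in> {0..1}" using q0 qz z by auto
  ultimately have "least_fixpoint P \<le> q"
    using least_fixpoint_is_least[OF P] by (auto simp: is_least_fixpoint_def)
  with qz show ?thesis by simp
qed

section \<open>The system induced by a policy\<close>

definition qnodes :: "'n system \<Rightarrow> 'n set" where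
  "qnodes R = {i. \<exists>j k. R i = QForm j k}"

definition fst_factor :: "'n system \<Rightarrow> 'n \<Rightarrow> 'n" where
  "fst_factor R i = (case R i of QForm j k \<Rightarrow> j | _ \<Rightarrow> i)"

definition snd_factor :: "'n system \<Rightarrow> 'n \<Rightarrow> 'n" where
  "snd_factor R i = (case R i of QForm j k \<Rightarrow> k | _ \<Rightarrow> i)"

text \<open>The Jacobian at the all-ones vector; the value at equations of form M is junk.\<close>

definition coef :: "'n system \<Rightarrow> 'n \<Rightarrow> 'n \<Rightarrow> real" where
  "coef R i v = (case R i of LForm c a \<Rightarrow> of_rat (a v)
     | QForm j k \<Rightarrow> of_bool (v = j) + of_bool (v = k) | MForm j k \<Rightarrow> 0)"

definition const_term :: "'n system \<Rightarrow> 'n \<Rightarrow> real" where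
  "const_term R i = (case R i of LForm c a \<Rightarrow> of_rat c | _ \<Rightarrow> 0)"

text \<open>The product serves in place of the least common multiple, as the bits of the
  denominators add up. The constant is left out because only the linear part must become
  integral.\<close>

definition coef_den :: "'n::finite system \<Rightarrow> 'n \<Rightarrow> real" where
  "coef_den R i = (case R i of LForm c a \<Rightarrow> (\<Prod>j | a j \<noteq> 0. of_int (den (a j))) | _ \<Rightarrow> 1)"

lemma LForm_bounds:
  fixes a :: "'n::finite \<Rightarrow> rat"
  assumes ok: "eqn_ok (LForm c a)"
  defines "b \<equiv> eqn_bits (LForm c a)" and "D \<equiv> \<Prod>j | a j \<noteq> 0. real_of_int (den (a j))"
    and "A \<equiv> (\<Sum>j\<in>UNIV. real_of_rat (a j))"
  shows "a j \<noteq> 0 \<Longrightarrow> 2 / 2 ^ b \<le> real_of_rat (a j)"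
    and "c \<noteq> 0 \<Longrightarrow> 2 / 2 ^ b \<le> real_of_rat c"
    and "of_rat c + A \<le> 1"
    and "of_rat c + A \<noteq> 1 \<Longrightarrow> 1 / 2 ^ b \<le> 1 - of_rat c - A"
    and "1 \<le> D" "D \<in> \<int>" "D * of_rat (a j) \<in> \<int>"
    and "D * (1 + A) \<le> 2 ^ b"
    and "c \<noteq> 0 \<or> a j \<noteq> 0 \<Longrightarrow> 1 \<le> b"
proof -
  define J where "J = {j. a j \<noteq> 0}"
  define v where "v = var_bits TYPE('n)"
  have v: "1 \<le> v" unfolding v_def by (rule var_bits_ge)
  have a0: "0 \<le> a j" and c0: "0 \<le> c" and sum1: "c + (\<Sum>j\<in>UNIV. a j) \<le> 1" for j
    using ok by auto
  have aJ: "0 < a j" if "j \<in> J" for j using that a0[of j] by (simp add: J_def)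
  define Dc where "Dc = (if c = 0 then 1 else real_of_int (den c))"
  have b: "b = (if c = 0 then 0 else rat_bits c) + (\<Sum>j\<in>J. rat_bits (a j) + v)"
    by (simp add: b_def J_def v_def)
  have D: "D = (\<Prod>j\<in>J. real_of_int (den (a j)))" by (simp add: D_def J_def)
  have div_mono: "2 / 2 ^ n \<ge> 2 / (2::real) ^ m" if "n \<le> m" for n m :: nat
    using that by (intro divide_left_mono power_increasing) auto
  have mem: "rat_bits (a j) + v \<le> (\<Sum>j\<in>J. rat_bits (a j) + v)" if "j \<in> J" for j
    using that by (intro member_le_sum) auto
  show 1: "2 / 2 ^ b \<le> real_of_rat (a j)" if "a j \<noteq> 0" for j
  proof -
    have "2 / 2 ^ b \<le> 2 / (2::real) ^ rat_bits (a j)"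
      using mem[of j] that by (intro div_mono) (simp add: b J_def)
    also have "\<dots> \<le> of_rat (a j)" using aJ that by (intro rat_ge_bits) (simp add: J_def)
    finally show ?thesis .
  qed
  show 2: "2 / 2 ^ b \<le> real_of_rat c" if "c \<noteq> 0"
  proof -
    have "2 / 2 ^ b \<le> 2 / (2::real) ^ rat_bits c" using that by (intro div_mono) (simp add: b)
    also have "\<dots> \<le> of_rat c" using c0 that by (intro rat_ge_bits) simp
    finally show ?thesis .
  qed
  have A: "A = of_rat (\<Sum>j\<in>UNIV. a j)" by (simp add: A_def of_rat_sum)
  then have cA: "of_rat c + A = of_rat (c + (\<Sum>j\<in>UNIV. a j))" by (simp add: of_rat_add)
  show 3: "of_rat c + A \<le> 1" unfolding cA using sum1 by simp
  have A0: "0 \<le> A" unfolding A_def using a0 by (intro sum_nonneg) simp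
  have "(0::real) \<le> of_rat c" using c0 by simp
  then have A1: "A \<le> 1" using 3 by linarith
  have D1: "1 \<le> D"
    unfolding D using den_pos by (intro prod_ge_1) (simp add: int_one_le_iff_zero_less)
  show "1 \<le> D" by (rule D1)
  show D_int: "D \<in> \<int>" unfolding D by auto
  show Da_int: "D * of_rat (a j) \<in> \<int>" for j
  proof (cases "j \<in> J")
    case True
    have "D * of_rat (a j) = (\<Prod>j\<in>J - {j}. real_of_int (den (a j))) * (of_rat (a j) * of_int (den (a j)))"
      unfolding D using True by (subst prod.remove[of _ j]) (auto simp: mult_ac)
    also have "\<dots> \<in> \<int>" by (intro Ints_mult times_den_Ints) auto
    finally show ?thesis .
  qed (simp add: J_def)
  \<comment> \<open>Each coefficient has two spare bits, from its numerator and its variable; the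
    resulting \<open>4 ^ card J\<close> pays for \<open>1 + A\<close> below.\<close>
  have D_pow: "4 ^ card J * D \<le> 2 ^ (\<Sum>j\<in>J. rat_bits (a j) + v)"
  proof -
    have "4 ^ card J * D = (\<Prod>j\<in>J. 2 * (2 * real_of_int (den (a j))))"
      by (simp add: D prod.distrib power_mult_distrib[symmetric])
    also have "\<dots> \<le> (\<Prod>j\<in>J. 2 ^ v * 2 ^ rat_bits (a j))"
    proof (intro prod_mono conjI mult_mono)
      fix j assume j: "j \<in> J"
      show "(2::real) \<le> 2 ^ v" using power_increasing[OF v, of "2::real"] by simp
      show "2 * real_of_int (den (a j)) \<le> 2 ^ rat_bits (a j)" by (rule den_le_bits[OF aJ[OF j]])
    qed (use den_pos in \<open>auto simp: less_imp_le\<close>)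
    also have "\<dots> = 2 ^ (\<Sum>j\<in>J. rat_bits (a j) + v)"
      by (simp add: power_sum power_add mult.commute)
    finally show ?thesis .
  qed
  have "(1 + A) \<le> 4 ^ card J"
  proof (cases "J = {}")
    case True
    then have "a = (\<lambda>_. 0)" by (auto simp: J_def)
    then show ?thesis using True by (simp add: A_def)
  next
    case False
    then have "1 \<le> card J" by (simp add: Suc_le_eq card_gt_0_iff)
    then have "(4::real) ^ 1 \<le> 4 ^ card J" by (intro power_increasing) auto
    then show ?thesis using A1 by simp
  qed
  then have "D * (1 + A) \<le> 4 ^ card J * D" using D1 by (simp add: mult.commute)
  also have "\<dots> \<le> 2 ^ (\<Sum>j\<in>J. rat_bits (a j) + v)" by (rule D_pow)
  also have "\<dots> \<le> 2 ^ b" unfolding b by (intro power_increasing) auto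
  finally show "D * (1 + A) \<le> 2 ^ b" .
  have Dc: "1 \<le> Dc" "Dc \<le> 2 ^ (if c = 0 then 0 else rat_bits c)" "Dc \<in> \<int>" "Dc * of_rat c \<in> \<int>"
  proof -
    show "1 \<le> Dc" using den_pos[of c] by (simp add: Dc_def)
    show "Dc \<le> 2 ^ (if c = 0 then 0 else rat_bits c)"
    proof (cases "c = 0")
      case False
      then have "2 * real_of_int (den c) \<le> 2 ^ rat_bits c" using c0 by (intro den_le_bits) simp
      moreover have "0 < real_of_int (den c)" using den_pos[of c] by simp
      ultimately have "real_of_int (den c) \<le> 2 ^ rat_bits c" by linarith
      then show ?thesis using False by (simp add: Dc_def)
    qed (simp add: Dc_def)
    show "Dc \<in> \<int>" by (simp add: Dc_def)
    show "Dc * of_rat c \<in> \<int>" using times_den_Ints[of c] by (simp add: Dc_def mult.commute)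
  qed
  have DcD: "Dc * D \<le> 2 ^ b"
  proof -
    have "D \<le> 4 ^ card J * D" using D1 by simp
    also note D_pow
    finally have "Dc * D \<le> 2 ^ (if c = 0 then 0 else rat_bits c) * 2 ^ (\<Sum>j\<in>J. rat_bits (a j) + v)"
      using Dc D1 by (intro mult_mono) auto
    then show ?thesis by (simp add: b power_add)
  qed
  show "1 / 2 ^ b \<le> 1 - of_rat c - A" if ne: "of_rat c + A \<noteq> 1"
  proof -
    \<comment> \<open>\<open>Dc * D\<close> is a common denominator of the constant and all
      coefficients, so a positive deficit times it is an integer, hence at least 1.\<close>
    have "Dc * D * (1 - of_rat c - A) = Dc * D - D * (Dc * of_rat c) - Dc * (\<Sum>j\<in>UNIV. D * of_rat (a j))"
      by (simp add: A_def sum_distrib_left[symmetric] algebra_simps)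
    also have "\<dots> \<in> \<int>"
      by (intro Ints_diff Ints_mult[OF Dc(3) D_int] Ints_mult[OF D_int Dc(4)]
          Ints_mult[OF Dc(3) Ints_sum[OF Da_int]])
    finally have int: "Dc * D * (1 - of_rat c - A) \<in> \<int>" .
    have pos: "0 < Dc * D * (1 - of_rat c - A)"
      using ne 3 Dc D1 by (intro mult_pos_pos) auto
    have "1 \<le> Dc * D * (1 - of_rat c - A)"
      using Ints_nonzero_abs_ge1[OF int] pos abs_of_pos[OF pos] by linarith
    also have "\<dots> \<le> 2 ^ b * (1 - of_rat c - A)"
      using 3 DcD by (intro mult_right_mono) auto
    finally show ?thesis by (simp add: field_simps)
  qed
  show "1 \<le> b" if "c \<noteq> 0 \<or> a j \<noteq> 0"
  proof (cases "c = 0")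
    case True
    then show ?thesis using that mem[of j] v by (simp add: b J_def)
  next
    case False
    then have "2 * real_of_int (den c) \<le> 2 ^ rat_bits c" using c0 by (intro den_le_bits) simp
    moreover have "1 \<le> real_of_int (den c)" using den_pos[of c] by simp
    ultimately have "rat_bits c \<noteq> 0" by (cases "rat_bits c") auto
    then show ?thesis using False by (simp add: b)
  qed
qed

lemma apply_policy_cases:
  obtains (L) c a where "P i = LForm c a" "apply_policy P \<sigma> i = LForm c a"
  | (Q) j k where "P i = QForm j k" "apply_policy P \<sigma> i = QForm j k"
  | (M) j k where "P i = MForm j k" "apply_policy P \<sigma> i = LForm 0 (\<lambda>v. if v = \<sigma> i then 1 else 0)"
  by (cases "P i") (auto simp: apply_policy_def)

text \<open>The budget counts the bits of \<open>P\<close>, not of \<open>R\<close>, so it serves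
  every policy. \<open>no_trap\<close> comes from minimality for \<open>P\<close>: a trap for
  \<open>R\<close> is one for \<open>P\<close>, since a minimum is at most the selected
  variable.\<close>

lemma policy_net:
  fixes P :: "'n::finite system"
  assumes P: "minPPS_SNF P" and q: "\<And>i. 0 < least_fixpoint P $ i" and \<sigma>: "is_policy P \<sigma>"
  defines "R \<equiv> apply_policy P \<sigma>"
  shows "quadratic_net (qnodes R) (fst_factor R) (snd_factor R) (coef R) (const_term R) (\<lambda>i. eqn_bits (P i)) (coef_den R)"
proof
  fix i j :: 'n
  let ?b = "eqn_bits (P i)"
  have ok: "eqn_ok (P i)" using P by (simp add: minPPS_SNF_def)
  have vb: "1 \<le> var_bits TYPE('n)" by (rule var_bits_ge)
  have fp: "eval_eqn (P i) (least_fixpoint P) = least_fixpoint P $ i" for i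
    using least_fixpoint_is_least[OF P]
    by (auto simp: is_least_fixpoint_def eval_sys_def vec_eq_iff)
  \<comment> \<open>Products and minima mention two variables of at least one bit each. A product
    row needs \<open>1 + 2 <= 4\<close>, a selected variable \<open>1 + 1 <= 4\<close>.\<close>
  have four: "(4::real) \<le> 2 ^ (2 * var_bits TYPE('n))"
    using power_increasing[of 2 "2 * var_bits TYPE('n)" "2::real"] vb by simp
  note defs = R_def qnodes_def fst_factor_def snd_factor_def coef_def const_term_def coef_den_def
  show "0 \<le> coef R i j"
    using ok by (cases rule: apply_policy_cases[of P i \<sigma>]) (auto simp: defs)
  show "coef R i j = of_bool (j = fst_factor R i) + of_bool (j = snd_factor R i)" if "i \<in> qnodes R"
    using that by (auto simp: defs)
  show "0 \<le> const_term R i"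
    using ok by (cases rule: apply_policy_cases[of P i \<sigma>]) (auto simp: defs)
  show "const_term R i + (\<Sum>j\<in>UNIV. coef R i j) \<le> 1" if "i \<notin> qnodes R"
  proof (cases rule: apply_policy_cases[of P i \<sigma>])
    case (L c a)
    then show ?thesis using that ok LForm_bounds(3)[of c a]
      by (simp add: defs del: eqn_bits.simps eqn_ok.simps)
  qed (use that in \<open>auto simp: defs if_distrib cong: if_cong\<close>)
  show "1 \<le> ?b"
  proof (cases "P i")
    case (LForm c a)
    have "\<exists>j. c \<noteq> 0 \<or> a j \<noteq> 0"
    proof (rule ccontr)
      assume "\<not> ?thesis"
      then show False using fp[of i] q[of i] LForm by simp
    qed
    then show ?thesis using LForm_bounds(9)[of c a] ok LForm by auto
  qed (use vb in auto)
  show "2 / 2 ^ ?b \<le> coef R i j" if "coef R i j \<noteq> 0"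
  proof (cases rule: apply_policy_cases[of P i \<sigma>])
    case (L c a)
    then show ?thesis using that ok LForm_bounds(1)[of c a j]
      by (simp add: defs del: eqn_bits.simps eqn_ok.simps)
  next
    case (Q k l)
    have "2 / 2 ^ ?b \<le> (1::real)" using four Q by simp
    also have "1 \<le> coef R i j" using that Q by (auto simp: defs of_bool_def split: if_splits)
    finally show ?thesis .
  next
    case (M k l)
    then show ?thesis using that four by (auto simp: defs split: if_splits)
  qed
  show "2 / 2 ^ ?b \<le> const_term R i" if "const_term R i \<noteq> 0"
  proof (cases rule: apply_policy_cases[of P i \<sigma>])
    case (L c a)
    then show ?thesis using that ok LForm_bounds(2)[of c a]
      by (simp add: defs del: eqn_bits.simps eqn_ok.simps)
  qed (use that in \<open>auto simp: defs\<close>)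
  show "1 / 2 ^ ?b \<le> 1 - const_term R i - (\<Sum>j\<in>UNIV. coef R i j)"
    if "i \<notin> qnodes R" "const_term R i + (\<Sum>j\<in>UNIV. coef R i j) \<noteq> 1"
  proof (cases rule: apply_policy_cases[of P i \<sigma>])
    case (L c a)
    then show ?thesis using that ok LForm_bounds(4)[of c a]
      by (simp add: defs del: eqn_bits.simps eqn_ok.simps)
  qed (use that in \<open>auto simp: defs if_distrib cong: if_cong\<close>)
  have ind: "{v. v = \<sigma> i} = {\<sigma> i}" by auto
  show "coef_den R i \<in> \<int>"
    by (cases rule: apply_policy_cases[of P i \<sigma>]) (auto simp: defs)
  show "1 \<le> coef_den R i"
  proof (cases rule: apply_policy_cases[of P i \<sigma>])
    case (L c a)
    then show ?thesis using ok LForm_bounds(5)[of c a]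
      by (simp add: defs del: eqn_bits.simps eqn_ok.simps)
  qed (auto simp: defs ind)
  show "coef_den R i * coef R i j \<in> \<int>"
  proof (cases rule: apply_policy_cases[of P i \<sigma>])
    case (L c a)
    then show ?thesis using ok LForm_bounds(7)[of c a j]
      by (simp add: defs del: eqn_bits.simps eqn_ok.simps)
  qed (auto simp: defs ind)
  show "coef_den R i * (1 + (\<Sum>j\<in>UNIV. coef R i j)) \<le> 2 ^ ?b"
  proof (cases rule: apply_policy_cases[of P i \<sigma>])
    case (L c a)
    then show ?thesis using ok LForm_bounds(8)[of c a]
      by (simp add: defs del: eqn_bits.simps eqn_ok.simps)
  next
    case (Q k l)
    have "(\<Sum>v\<in>UNIV. of_bool (v = w)) = (1::real)" for w :: 'n by (simp add: of_bool_def)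
    then show ?thesis using Q four by (simp add: defs sum.distrib)
  qed (use four in \<open>auto simp: defs ind if_distrib cong: if_cong\<close>)
next
  fix W :: "'n set"
  assume W: "W \<noteq> {}" "W \<inter> qnodes R = {}"
  let ?q = "least_fixpoint P"
  show "\<exists>i\<in>W. const_term R i \<noteq> 0 \<or> (\<exists>j. coef R i j \<noteq> 0 \<and> j \<notin> W)"
  proof (rule ccontr)
    assume "\<not> ?thesis"
    then have c0: "const_term R i = 0" and closed: "coef R i j \<noteq> 0 \<Longrightarrow> j \<in> W" if "i \<in> W" for i j
      using that by auto
    txt \<open>Resetting the least fixed point to \<open>0\<close> on \<open>W\<close> yields a smaller pre-fixed point.\<close>
    define z where "z = (\<chi> i. if i \<in> W then 0 else ?q $ i)"
    have lfp: "is_least_fixpoint P ?q" by (rule least_fixpoint_is_least[OF P])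
    have z: "0 \<le> z" "z \<le> ?q" using q by (auto simp: z_def less_eq_vec_def less_imp_le)
    have "eval_sys P z \<le> z"
      unfolding less_eq_vec_def
    proof
      fix i
      show "eval_sys P z $ i \<le> z $ i"
      proof (cases "i \<in> W")
        case False
        have "eval_sys P z $ i \<le> eval_sys P ?q $ i"
          using eval_sys_mono[OF P z] by (simp add: less_eq_vec_def)
        also have "\<dots> = z $ i" using False lfp by (simp add: is_least_fixpoint_def z_def)
        finally show ?thesis .
      next
        case True
        note defs = R_def qnodes_def coef_def const_term_def
        have "eval_eqn (P i) z \<le> 0"
        proof (cases rule: apply_policy_cases[of P i \<sigma>])
          case (L c a)
          then have "c = 0" using c0[OF True] by (simp add: defs)
          moreover have "(\<Sum>j\<in>UNIV. real_of_rat (a j) * z $ j) = 0"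
            using closed[OF True] L by (intro sum.neutral) (auto simp: defs z_def)
          ultimately show ?thesis using L by simp
        next
          case (Q j k)
          then show ?thesis using True W by (auto simp: defs)
        next
          case (M j k)
          then have "\<sigma> i \<in> W" using closed[OF True, of "\<sigma> i"] by (simp add: defs)
          moreover have "\<sigma> i \<in> {j, k}" using \<sigma> M by (auto simp: is_policy_def)
          ultimately show ?thesis using M by (auto simp: z_def min_def)
        qed
        then show ?thesis using True by (simp add: eval_sys_def z_def)
      qed
    qed
    moreover have "z \<in> {0..1}" using z lfp by (auto simp: is_least_fixpoint_def)
    ultimately have "?q \<le> z" by (intro least_fixpoint_le P)
    moreover obtain i where "i \<in> W" using W by auto
    ultimately have "?q $ i \<le> 0" by (auto simp: less_eq_vec_def z_def split: if_splits)
    then show False using q[of i] by simp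
  qed
qed

lemma eval_apply_policy:
  fixes P :: "'n::finite system" and \<sigma> :: "'n \<Rightarrow> 'n"
  defines "R \<equiv> apply_policy P \<sigma>"
  shows "eval_eqn (R i) x = (if i \<in> qnodes R then x $ fst_factor R i * x $ snd_factor R i
    else const_term R i + (\<Sum>j\<in>UNIV. coef R i j * x $ j))"
  by (cases rule: apply_policy_cases[of P i \<sigma>])
    (auto simp: R_def qnodes_def fst_factor_def snd_factor_def coef_def const_term_def)

section \<open>From fixed policies back to minimum systems\<close>

text \<open>A policy greedy at the least fixed point of \<open>P\<close> keeps it fixed. It need not
  be least for the policy system: \<open>fixpoint_gap\<close> asks only for a fixed point and
  \<open>no_trap\<close>, which \<open>P\<close> provides.\<close>

lemma least_fixpoint_gap:
  fixes P :: "'n::finite system"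
  assumes P: "minPPS_SNF P"
    and q: "\<And>i. 0 < least_fixpoint P $ i" "\<And>i. least_fixpoint P $ i < 1"
  shows "1 / 2 ^ (4 * sys_bits P) \<le> 1 - least_fixpoint P $ i"
proof -
  let ?q = "least_fixpoint P"
  define \<tau> where "\<tau> i = (case P i of MForm j k \<Rightarrow> if ?q $ j \<le> ?q $ k then j else k | _ \<Rightarrow> i)" for i
  have \<tau>: "is_policy P \<tau>" by (auto simp: is_policy_def \<tau>_def)
  interpret quadratic_net "qnodes (apply_policy P \<tau>)" "fst_factor (apply_policy P \<tau>)"
    "snd_factor (apply_policy P \<tau>)" "coef (apply_policy P \<tau>)" "const_term (apply_policy P \<tau>)"
    "\<lambda>i. eqn_bits (P i)" "coef_den (apply_policy P \<tau>)"
    by (rule policy_net[OF P q(1) \<tau>])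
  have "ev (($) ?q) i = ?q $ i" for i
  proof -
    have "eval_eqn (P i) ?q = ?q $ i"
      using least_fixpoint_is_least[OF P]
      by (auto simp: is_least_fixpoint_def eval_sys_def vec_eq_iff)
    moreover have "eval_eqn (apply_policy P \<tau> i) ?q = eval_eqn (P i) ?q"
      by (cases rule: apply_policy_cases[of P i \<tau>])
        (auto simp: \<tau>_def if_distrib[of of_rat] if_distrib[of "\<lambda>x. x * _"] min_def cong: if_cong)
    ultimately show ?thesis by (simp add: ev_def eval_apply_policy)
  qed
  from fixpoint_gap[OF q this] show ?thesis by (simp add: nbits_def sys_bits_def)
qed

theorem theorem4p6:
  fixes P :: "'n::finite system" and y :: "real ^ 'n" and \<epsilon> :: real
    and \<sigma> :: "'n \<Rightarrow> 'n"
  assumes "minPPS_SNF P"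
    and "\<forall>i. 0 < least_fixpoint P $ i \<and> least_fixpoint P $ i < 1"
    and "0 \<le> \<epsilon>" and "\<epsilon> \<le> 1"
    and "0 \<le> y" and "y \<le> least_fixpoint P"
    and "infnorm (least_fixpoint P - y) \<le> 2 powr (- 14 * real (sys_bits P) - 3) * \<epsilon>"
    and "is_policy P \<sigma>"
    and "eval_sys (apply_policy P \<sigma>) y = eval_sys P y"
  shows "infnorm (least_fixpoint P - least_fixpoint (apply_policy P \<sigma>)) \<le> \<epsilon>"
proof -
  note P = assms(1)
  let ?R = "apply_policy P \<sigma>"
  define q where "q = least_fixpoint P"
  have q: "\<And>i. 0 < q $ i" "\<And>i. q $ i < 1" using assms(2) by (auto simp: q_def)
  have R: "minPPS_SNF ?R" by (rule minPPS_SNF_apply_policy[OF P])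
  interpret quadratic_net "qnodes ?R" "fst_factor ?R" "snd_factor ?R" "coef ?R" "const_term ?R"
    "\<lambda>i. eqn_bits (P i)" "coef_den ?R"
    by (rule policy_net[OF P q(1)[unfolded q_def] assms(8)])
  have nbits: "nbits = sys_bits P" by (simp add: nbits_def sys_bits_def)
  define \<delta> where "\<delta> = \<epsilon> / 2 ^ (14 * nbits + 3)"
  have \<delta>: "0 \<le> \<delta>" using assms(3) by (simp add: \<delta>_def)
  have ev: "ev (($) x) i = eval_eqn (?R i) x" for x i
    by (simp add: ev_def eval_apply_policy)
  have "- 14 * real (sys_bits P) - 3 = - real (14 * nbits + 3)" by (simp add: nbits)
  then have "2 powr (- 14 * real (sys_bits P) - 3) * \<epsilon> = \<delta>"
    by (simp only: powr_minus powr_realpow) (simp add: \<delta>_def field_simps)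
  then have qy: "\<bar>q $ i - y $ i\<bar> \<le> \<delta>" for i
    using assms(7) component_le_infnorm_cart[of "q - y" i] by (simp add: q_def)
  have yq: "y $ i \<le> q $ i" for i using assms(6) by (simp add: q_def less_eq_vec_def)
  have fp: "eval_eqn (P i) q = q $ i" for i
    using least_fixpoint_is_least[OF P]
    by (auto simp: is_least_fixpoint_def eval_sys_def vec_eq_iff q_def)
  \<comment> \<open>The policy agrees with the minimum at \<open>y\<close>, so the selected variable
    has value at most \<open>q $ i\<close> there, and passing from \<open>y\<close> to
    \<open>q\<close> costs at most \<open>\<delta>\<close>.\<close>
  have ev_M: "ev (($) q) i = q $ \<sigma> i" "q $ i \<le> q $ \<sigma> i" "q $ \<sigma> i \<le> q $ i + \<delta>"
    if M: "P i = MForm j k" for i j k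
  proof -
    have Ri: "eval_eqn (?R i) x = x $ \<sigma> i" for x
      using M by (simp add: apply_policy_def if_distrib[of of_rat] if_distrib[of "\<lambda>x. x * _"] cong: if_cong)
    then show "ev (($) q) i = q $ \<sigma> i" by (simp add: ev)
    have "\<sigma> i \<in> {j, k}" using assms(8) M by (auto simp: is_policy_def)
    then show "q $ i \<le> q $ \<sigma> i" using fp[of i] M by auto
    have "y $ \<sigma> i = eval_eqn (P i) y" using assms(9) Ri[of y] by (simp add: eval_sys_def vec_eq_iff)
    also have "\<dots> \<le> q $ i" using fp[of i] M yq[of j] yq[of k] by auto
    finally show "q $ \<sigma> i \<le> q $ i + \<delta>" using qy[of "\<sigma> i"] by simp
  qed
  have ev_LQ: "ev (($) q) i = q $ i" if "\<And>j k. P i \<noteq> MForm j k" for i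
    unfolding ev using that fp[of i] by (cases rule: apply_policy_cases[of P i \<sigma>]) auto
  have bounds: "q $ i \<le> ev (($) q) i" "ev (($) q) i \<le> q $ i + \<delta>" for i
    using ev_M[of i] ev_LQ[of i] \<delta> by (cases "P i"; simp)+
  \<comment> \<open>A selected variable is an affine equation of total weight 1, so minima become
    neither products nor deficient equations, and only minima carry an error.\<close>
  have exact: "ev (($) q) i = q $ i" if "i \<in> qnodes ?R \<union> deficient" for i
  proof (rule ev_LQ)
    fix j k
    show "P i \<noteq> MForm j k"
    proof
      assume "P i = MForm j k"
      then have "?R i = LForm 0 (\<lambda>v. if v = \<sigma> i then 1 else 0)" by (simp add: apply_policy_def)
      then show False using that unfolding deficient_def
        by (simp add: qnodes_def const_term_def coef_def if_distrib[of of_rat] cong: if_cong)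
    qed
  qed
  obtain z where z: "\<And>i. q $ i \<le> z i" "\<And>i. z i \<le> q $ i + \<epsilon>" "\<And>i. z i \<le> 1" "\<And>i. ev z i \<le> z i"
  proof (rule stability[of "($) q" \<epsilon>])
    show "1 / 2 ^ (4 * nbits) \<le> 1 - q $ i" for i
      unfolding nbits q_def by (rule least_fixpoint_gap[OF P q[unfolded q_def]])
  qed (use q assms(3,4) bounds exact \<delta>_def that in auto)
  define Z where "Z = (\<chi> i. z i)"
  have Z: "($) Z = z" by (auto simp: Z_def)
  have "eval_sys ?R Z \<le> Z"
    using z(4) by (simp add: less_eq_vec_def eval_sys_def ev[symmetric] Z)
  moreover have "Z \<in> {0..1}"
    using z(1,3) q(1) by (auto simp: less_eq_vec_def Z intro: order_trans[OF less_imp_le])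
  ultimately have up: "least_fixpoint ?R \<le> Z" by (intro least_fixpoint_le R)
  have lfpR: "is_least_fixpoint ?R (least_fixpoint ?R)" by (rule least_fixpoint_is_least[OF R])
  \<comment> \<open>A minimum is at most the selected variable, so the fixed point of the policy
    system is pre-fixed for \<open>P\<close>.\<close>
  have "eval_sys P (least_fixpoint ?R) \<le> eval_sys ?R (least_fixpoint ?R)"
    unfolding less_eq_vec_def
  proof
    fix i
    show "eval_sys P (least_fixpoint ?R) $ i \<le> eval_sys ?R (least_fixpoint ?R) $ i"
      using assms(8)
      by (cases rule: apply_policy_cases[of P i \<sigma>])
        (force simp: eval_sys_def is_policy_def if_distrib[of of_rat] if_distrib[of "\<lambda>x. x * _"]
          cong: if_cong)+
  qed
  then have low: "q \<le> least_fixpoint ?R"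
    unfolding q_def using lfpR by (intro least_fixpoint_le P) (auto simp: is_least_fixpoint_def)
  have "\<bar>(q - least_fixpoint ?R) $ i\<bar> \<le> \<epsilon>" for i
    using z(2)[of i] up low by (simp add: less_eq_vec_def Z) (smt (verit, best))
  then show ?thesis
    unfolding infnorm_cart q_def by (auto intro!: cSup_least)
qed

end
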